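(* Let $M$ be a Kähler manifold of complex dimension $m$. A horizontal pluriharmonic map $\tau_1=(\tau',N,\tau'') : M\to Z_1$ is the complex Gauss map of a Kähler immersion $f : M\to S^{n-1}\subset\mathbb{R}^n$ with parallel pluri-mean curvature if and only if there exists a real section $f$ of $N$ (i.e. a smooth map $f : M\to\mathbb{R}^n$ with $f(p)\in N_p$ for all $p\in M$) such that $df(T')=\tau'$.
   Context: For a complex manifold $M$ with almost complex structure $J$, $T^cM=TM\otimes\mathbb{C}=T'\oplus T''$ with $J=i$ on $T'$ and $J=-i$ on $T''$; differentials are extended complex linearly. A Kähler immersion $f : M\to\mathbb{R}^n$ is an immersion such that the induced metric on $M$ is Kähler for the given complex structure, i.e. $J$ is orthogonal and parallel for the induced metric. With $\alpha$ its second fundamental form, $f$ has parallel pluri-mean curvature if $\alpha^{(1,1)}(x,y)=\frac12(\alpha(x,y)+\alpha(Jx,Jy))$ is parallel with respect to the (induced) tangent and normal connections. $Z_1$ is the set of $m$-dimensional complex subspaces $E\subset\mathbb{C}^n$ that are isotropic, i.e. $\langle x,y\rangle=\sum_jx_jy_j$ vanishes on $E\times E$. Identify $E\in Z_1$ with the orthogonal decomposition $(E,(E+\bar E)^\perp,\bar E)$ of $\mathbb{C}^n$ ($\perp$ for the Hermitian inner product); so a map into $Z_1$ is written $\tau_1=(\tau',N,\tau'')$ with $\tau''=\overline{\tau'}$, $N=(\tau'+\tau'')^\perp$. $Z_1=O_n/(U_m\times O_{n-2m})$ fibers over the Grassmannian $Gr$ of $2m$-planes in $\mathbb{R}^n$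 by $\pi(E)=E+\bar E$ (real subspaces identified with conjugation-invariant complex subspaces) and carries an $O_n$-invariant metric, for which $\pi$ is (up to scaling) a Riemannian submersion. A tangent vector at $E$, viewed in $\mathrm{Hom}(E,E^\perp)$, is horizontal if it maps $E$ into $(E+\bar E)^\perp$; a map into $Z_1$ is horizontal if its differential takes horizontal values. A smooth map $\phi : M\to Z$ into a Riemannian manifold is pluriharmonic if its Hessian $Dd\phi$ vanishes on $T'\otimes T''$. The complex Gauss map of a Kähler immersion $f$ is $p\mapsto\tau'(p)=df_p(T'_pM)\in Z_1$, equivalently $\tau_1=(\tau',N,\tau'')$. *)

theory Defs
  imports "HOL-Analysis.Analysis"
begin

section \<open>Calculus on open subsets of a normed space\<close>

abbreviation pd :: "('e::real_normed_vector \<Rightarrow> 'b::real_normed_vector) \<Rightarrow> 'e \<Rightarrow> 'e \<Rightarrow> 'b"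
  where "pd F x v \<equiv> frechet_derivative F (at x) v"

fun k_smooth_on :: "nat \<Rightarrow> 'e::real_normed_vector set \<Rightarrow> ('e \<Rightarrow> 'b::real_normed_vector) \<Rightarrow> bool"
  where
    "k_smooth_on 0 S F \<longleftrightarrow> continuous_on S F"
  | "k_smooth_on (Suc k) S F \<longleftrightarrow>
       (\<forall>x\<in>S. F differentiable (at x)) \<and> (\<forall>v. k_smooth_on k S (\<lambda>x. pd F x v))"

definition smooth_on :: "'e::real_normed_vector set \<Rightarrow> ('e \<Rightarrow> 'b::real_normed_vector) \<Rightarrow> bool"
  where "smooth_on S F \<longleftrightarrow> (\<forall>k. k_smooth_on k S F)"

definition orth_proj :: "'b::euclidean_space set \<Rightarrow> 'b \<Rightarrow> 'b"
  where "orth_proj S x = (THE y. y \<in> span S \<and> (\<forall>z\<in>S. orthogonal (x - y) z))"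

definition normal_part :: "'b::euclidean_space set \<Rightarrow> 'b \<Rightarrow> 'b"
  where "normal_part S x = x - orth_proj S x"

text \<open>Christoffel map of a metric \<open>h\<close> given in coordinates, by the Koszul formula for constant
  vector fields; the Levi-Civita connection is \<open>\<nabla>\<^sub>v W = \<partial>\<^sub>v W + \<Gamma>(v, W)\<close>.\<close>

definition christoffel ::
    "('e::real_normed_vector \<Rightarrow> 'e \<Rightarrow> 'e \<Rightarrow> real) \<Rightarrow> 'e \<Rightarrow> 'e \<Rightarrow> 'e \<Rightarrow> 'e"
  where "christoffel h x v w =
    (THE z. \<forall>u. h x z u =
       (pd (\<lambda>y. h y w u) x v + pd (\<lambda>y. h y v u) x w - pd (\<lambda>y. h y v w) x u) / 2)"


section \<open>Complexification\<close>

text \<open>The pair \<open>(v, w)\<close> stands for \<open>v + i w\<close> in the complexification of a real vector space.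
  The real space may itself be a space of complex vectors or matrices; its own multiplication
  by \<open>i\<close> then differs from the formal one used here.\<close>

definition lin_ext :: "('e \<Rightarrow> 'b) \<Rightarrow> 'e \<times> 'e \<Rightarrow> 'b \<times> 'b"
  where "lin_ext L X = (L (fst X), L (snd X))"

definition bil_ext :: "('e \<Rightarrow> 'e \<Rightarrow> 'b::ab_group_add) \<Rightarrow> 'e \<times> 'e \<Rightarrow> 'e \<times> 'e \<Rightarrow> 'b \<times> 'b"
  where "bil_ext B X Y =
    (B (fst X) (fst Y) - B (snd X) (snd Y), B (fst X) (snd Y) + B (snd X) (fst Y))"

definition mult_i :: "'e::ab_group_add \<times> 'e \<Rightarrow> 'e \<times> 'e"
  where "mult_i X = (- snd X, fst X)"

definition to_complex_vec :: "(real^'n) \<times> (real^'n) \<Rightarrow> complex^'n"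
  where "to_complex_vec X = (\<chi> j. Complex (fst X $ j) (snd X $ j))"

definition complex_vec :: "real^'n \<Rightarrow> complex^'n"
  where "complex_vec x = (\<chi> j. complex_of_real (x $ j))"


section \<open>Complex and Kaehler manifolds\<close>

text \<open>The underlying space of the manifold is the type \<open>'a\<close>; a chart consists of its domain and its
  coordinate map. Tangent vectors at a point of a chart domain are represented by their coordinates,
  so that in every chart \<open>J\<close> is multiplication by \<open>i\<close>.\<close>

type_synonym ('a, 'm) chart = "'a set \<times> ('a \<Rightarrow> complex^'m)"

abbreviation chart_dom :: "('a, 'm) chart \<Rightarrow> 'a set"
  where "chart_dom c \<equiv> fst c"

abbreviation coord :: "('a, 'm) chart \<Rightarrow> 'a \<Rightarrow> complex^'m"
  where "coord c \<equiv> snd c"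

definition chart_ran :: "('a, 'm) chart \<Rightarrow> (complex^'m) set"
  where "chart_ran c = coord c ` chart_dom c"

definition param :: "('a, 'm) chart \<Rightarrow> complex^'m \<Rightarrow> 'a"
  where "param c = inv_into (chart_dom c) (coord c)"

definition J :: "complex^'m \<Rightarrow> complex^'m"
  where "J v = \<i> *s v"

definition holomorphic_map_on :: "(complex^'m::finite) set \<Rightarrow> (complex^'m \<Rightarrow> complex^'m) \<Rightarrow> bool"
  where "holomorphic_map_on S F \<longleftrightarrow>
    smooth_on S F \<and> (\<forall>x\<in>S. \<forall>v. pd F x (J v) = J (pd F x v))"

definition complex_atlas ::
    "('a::{t2_space, second_countable_topology}, 'm::finite) chart set \<Rightarrow> bool"
  where "complex_atlas A \<longleftrightarrow>
    (\<Union>c\<in>A. chart_dom c) = UNIV \<and>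
    (\<forall>c\<in>A. open (chart_dom c) \<and> open (chart_ran c) \<and>
       homeomorphism (chart_dom c) (chart_ran c) (coord c) (param c)) \<and>
    (\<forall>c\<in>A. \<forall>d\<in>A.
       holomorphic_map_on (coord c ` (chart_dom c \<inter> chart_dom d)) (coord d \<circ> param c))"

definition smooth_map :: "('a, 'm::finite) chart set \<Rightarrow> ('a \<Rightarrow> 'b::real_normed_vector) \<Rightarrow> bool"
  where "smooth_map A \<phi> \<longleftrightarrow> (\<forall>c\<in>A. smooth_on (chart_ran c) (\<phi> \<circ> param c))"

definition T10 :: "((complex^'m) \<times> (complex^'m)) set"
  where "T10 = {X. lin_ext J X = mult_i X}"

definition T01 :: "((complex^'m) \<times> (complex^'m)) set"
  where "T01 = {X. lin_ext J X = - mult_i X}"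

text \<open>\<open>g c x v w\<close> is the value, at the point with coordinates \<open>x\<close> in the chart \<open>c\<close>, on the tangent
  vectors with coordinates \<open>v\<close> and \<open>w\<close>.\<close>

type_synonym ('a, 'm) metric =
  "('a, 'm) chart \<Rightarrow> complex^'m \<Rightarrow> complex^'m \<Rightarrow> complex^'m \<Rightarrow> real"

definition riemannian_metric :: "('a, 'm::finite) chart set \<Rightarrow> ('a, 'm) metric \<Rightarrow> bool"
  where "riemannian_metric A g \<longleftrightarrow>
    (\<forall>c\<in>A. \<forall>x\<in>chart_ran c. bilinear (g c x) \<and>
       (\<forall>v w. g c x v w = g c x w v) \<and> (\<forall>v. v \<noteq> 0 \<longrightarrow> g c x v v > 0)) \<and>
    (\<forall>c\<in>A. \<forall>v w. smooth_on (chart_ran c) (\<lambda>x. g c x v w)) \<and>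
    (\<forall>c\<in>A. \<forall>d\<in>A. \<forall>p \<in> chart_dom c \<inter> chart_dom d. \<forall>v w.
       g c (coord c p) v w =
       g d (coord d p) (pd (coord d \<circ> param c) (coord c p) v)
                       (pd (coord d \<circ> param c) (coord c p) w))"

text \<open>\<open>J\<close> is orthogonal and parallel for the metric: as \<open>J\<close> is constant in every chart,
  \<open>(\<nabla>\<^sub>v J) w = \<Gamma>(v, J w) - J \<Gamma>(v, w)\<close>.\<close>

definition kaehler_condition :: "('a, 'm::finite) chart set \<Rightarrow> ('a, 'm) metric \<Rightarrow> bool"
  where "kaehler_condition A g \<longleftrightarrow>
    (\<forall>c\<in>A. \<forall>x\<in>chart_ran c. \<forall>v w.
       g c x (J v) (J w) = g c x v w \<and>
       christoffel (g c) x v (J w) = J (christoffel (g c) x v w))"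

definition kaehler_manifold ::
    "('a::{t2_space, second_countable_topology}, 'm::finite) chart set \<Rightarrow> ('a, 'm) metric \<Rightarrow> bool"
  where "kaehler_manifold A g \<longleftrightarrow>
    complex_atlas A \<and> riemannian_metric A g \<and> kaehler_condition A g"


section \<open>Pluriharmonic maps into submanifolds of Euclidean space\<close>

text \<open>Velocities of curves in \<open>S\<close> through \<open>z\<close>; for a submanifold \<open>S\<close> this is the tangent space.\<close>

definition tangent_space :: "'b::real_normed_vector set \<Rightarrow> 'b \<Rightarrow> 'b set"
  where "tangent_space S z =
    {v. \<exists>\<gamma>. \<gamma> 0 = z \<and> (\<forall>t::real. \<gamma> t \<in> S) \<and> (\<gamma> has_vector_derivative v) (at 0)}"

text \<open>The Hessian \<open>Dd\<phi>(v, w) = D\<^sub>v (d\<phi> w) - d\<phi> (\<nabla>\<^sub>v w)\<close> of a map \<open>\<phi>\<close> into a submanifold \<open>S\<close> of a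
  Euclidean space with the induced metric, whose Levi-Civita connection is the tangential part of
  the flat one.\<close>

definition hessian ::
    "('a, 'm::finite) metric \<Rightarrow> 'b::euclidean_space set \<Rightarrow> ('a \<Rightarrow> 'b) \<Rightarrow> ('a, 'm) chart \<Rightarrow>
     complex^'m \<Rightarrow> complex^'m \<Rightarrow> complex^'m \<Rightarrow> 'b"
  where "hessian g S \<phi> c x v w =
    (let \<Phi> = \<phi> \<circ> param c in
       orth_proj (tangent_space S (\<Phi> x)) (pd (\<lambda>y. pd \<Phi> y w) x v)
       - pd \<Phi> x (christoffel (g c) x v w))"

definition pluriharmonic ::
    "('a, 'm::finite) chart set \<Rightarrow> ('a, 'm) metric \<Rightarrow> 'b::euclidean_space set \<Rightarrow> ('a \<Rightarrow> 'b) \<Rightarrow> bool"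
  where "pluriharmonic A g S \<phi> \<longleftrightarrow>
    smooth_map A \<phi> \<and> (\<forall>p. \<phi> p \<in> S) \<and>
    (\<forall>c\<in>A. \<forall>x\<in>chart_ran c. \<forall>X\<in>T10. \<forall>Y\<in>T01. bil_ext (hessian g S \<phi> c x) X Y = 0)"


section \<open>The space of isotropic subspaces\<close>

definition bil :: "complex^'n \<Rightarrow> complex^'n \<Rightarrow> complex"
  where "bil x y = (\<Sum>j\<in>UNIV. x $ j * y $ j)"

definition herm :: "complex^'n \<Rightarrow> complex^'n \<Rightarrow> complex"
  where "herm x y = (\<Sum>j\<in>UNIV. x $ j * cnj (y $ j))"

definition herm_perp :: "(complex^'n) set \<Rightarrow> (complex^'n) set"
  where "herm_perp S = {z. \<forall>x\<in>S. herm z x = 0}"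

definition conj_space :: "(complex^'n) set \<Rightarrow> (complex^'n) set"
  where "conj_space E = (\<lambda>x. \<chi> j. cnj (x $ j)) ` E"

definition Z1 :: "nat \<Rightarrow> (complex^'n::finite) set set"
  where "Z1 m = {E. vec.subspace E \<and> vec.dim E = m \<and> (\<forall>x\<in>E. \<forall>y\<in>E. bil x y = 0)}"

text \<open>The middle part \<open>N\<close> of the decomposition belonging to \<open>E\<close>.\<close>

definition N_of :: "(complex^'n) set \<Rightarrow> (complex^'n) set"
  where "N_of E = herm_perp {x + y | x y. x \<in> E \<and> y \<in> conj_space E}"

text \<open>\<open>Z1 m\<close> is regarded as a submanifold of the space of complex matrices by sending \<open>E\<close> to the
  Hermitian projection onto \<open>E\<close>, with the metric induced from the inner product
  \<open>Re (tr (A B\<^sup>*))\<close>. This metric is invariant under \<open>O\<^sub>n\<close>. A tangent vector at \<open>E\<close> is a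
  Hermitian matrix \<open>a + a\<^sup>*\<close> with \<open>a \<in> Hom(E, E\<^sup>\<bottom>)\<close> (extended by zero), of squared length
  \<open>2 |a|\<^sup>2\<close>; the horizontal ones, with \<open>a\<close> in \<open>Hom(E, N)\<close>, are orthogonal to the vertical ones, with
  \<open>a\<close> in \<open>Hom(E, conj E)\<close>, and \<open>E \<mapsto> E + conj E\<close> is a Riemannian submersion up to scaling.\<close>

definition proj_mat :: "(complex^'n::finite) set \<Rightarrow> complex^'n^'n"
  where "proj_mat E = (THE P. \<forall>x. P *v x \<in> E \<and> x - P *v x \<in> herm_perp E)"

definition pluriharmonic_Z1 ::
    "('a, 'm::finite) chart set \<Rightarrow> ('a, 'm) metric \<Rightarrow> ('a \<Rightarrow> (complex^'n::finite) set) \<Rightarrow> bool"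
  where "pluriharmonic_Z1 A g \<tau> \<longleftrightarrow>
    pluriharmonic A g (proj_mat ` Z1 CARD('m)) (\<lambda>p. proj_mat (\<tau> p))"

text \<open>The homomorphism \<open>E \<rightarrow> E\<^sup>\<bottom>\<close> given by a tangent vector of \<open>Z1 m\<close> at \<open>E\<close> is the
  restriction to \<open>E\<close> of the corresponding matrix.\<close>

definition horizontal_vector :: "(complex^'n::finite) set \<Rightarrow> complex^'n^'n \<Rightarrow> bool"
  where "horizontal_vector E a \<longleftrightarrow> (\<forall>x\<in>E. a *v x \<in> N_of E)"

definition horizontal_Z1 ::
    "('a, 'm::finite) chart set \<Rightarrow> ('a \<Rightarrow> (complex^'n::finite) set) \<Rightarrow> bool"
  where "horizontal_Z1 A \<tau> \<longleftrightarrow>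
    (\<forall>c\<in>A. \<forall>x\<in>chart_ran c. \<forall>v.
       horizontal_vector (\<tau> (param c x)) (pd ((\<lambda>p. proj_mat (\<tau> p)) \<circ> param c) x v))"


section \<open>Kaehler immersions\<close>

definition induced_metric :: "('a \<Rightarrow> real^'n::finite) \<Rightarrow> ('a, 'm::finite) metric"
  where "induced_metric f c x v w = pd (f \<circ> param c) x v \<bullet> pd (f \<circ> param c) x w"

definition kaehler_immersion ::
    "('a, 'm::finite) chart set \<Rightarrow> ('a \<Rightarrow> real^'n::finite) \<Rightarrow> bool"
  where "kaehler_immersion A f \<longleftrightarrow>
    smooth_map A f \<and>
    (\<forall>c\<in>A. \<forall>x\<in>chart_ran c. inj (pd (f \<circ> param c) x)) \<and>
    kaehler_condition A (induced_metric f)"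

definition normal_proj ::
    "('a \<Rightarrow> real^'n::finite) \<Rightarrow> ('a, 'm::finite) chart \<Rightarrow> complex^'m \<Rightarrow> real^'n \<Rightarrow> real^'n"
  where "normal_proj f c x = normal_part (range (pd (f \<circ> param c) x))"

definition second_ff ::
    "('a \<Rightarrow> real^'n::finite) \<Rightarrow> ('a, 'm::finite) chart \<Rightarrow>
     complex^'m \<Rightarrow> complex^'m \<Rightarrow> complex^'m \<Rightarrow> real^'n"
  where "second_ff f c x v w = normal_proj f c x (pd (\<lambda>y. pd (f \<circ> param c) y w) x v)"

definition second_ff11 ::
    "('a \<Rightarrow> real^'n::finite) \<Rightarrow> ('a, 'm::finite) chart \<Rightarrow>
     complex^'m \<Rightarrow> complex^'m \<Rightarrow> complex^'m \<Rightarrow> real^'n"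
  where "second_ff11 f c x v w =
    (1/2) *\<^sub>R (second_ff f c x v w + second_ff f c x (J v) (J w))"

text \<open>\<open>(\<nabla>\<^sub>u \<beta>)(v, w) = \<nabla>\<^sup>\<bottom>\<^sub>u (\<beta>(v, w)) - \<beta>(\<nabla>\<^sub>u v, w) - \<beta>(v, \<nabla>\<^sub>u w)\<close>
  vanishes for \<open>\<beta> = second_ff11\<close> and all coordinate vector fields \<open>v\<close>, \<open>w\<close>, for which
  \<open>\<nabla>\<^sub>u v = \<Gamma>(u, v)\<close>.\<close>

definition parallel_pluri_mean_curvature ::
    "('a, 'm::finite) chart set \<Rightarrow> ('a \<Rightarrow> real^'n::finite) \<Rightarrow> bool"
  where "parallel_pluri_mean_curvature A f \<longleftrightarrow>
    (\<forall>c\<in>A. \<forall>x\<in>chart_ran c. \<forall>u v w.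
       normal_proj f c x (pd (\<lambda>y. second_ff11 f c y v w) x u)
       - second_ff11 f c x (christoffel (induced_metric f c) x u v) w
       - second_ff11 f c x v (christoffel (induced_metric f c) x u w) = 0)"

text \<open>\<open>df(T') = \<tau>\<close>, with \<open>df\<close> extended complex linearly.\<close>

definition image_T10_eq ::
    "('a, 'm::finite) chart set \<Rightarrow> ('a \<Rightarrow> real^'n::finite) \<Rightarrow> ('a \<Rightarrow> (complex^'n) set) \<Rightarrow> bool"
  where "image_T10_eq A f \<tau> \<longleftrightarrow>
    (\<forall>c\<in>A. \<forall>x\<in>chart_ran c.
       (to_complex_vec \<circ> lin_ext (pd (f \<circ> param c) x)) ` T10 = \<tau> (param c x))"

definition is_complex_gauss_map ::
    "('a, 'm::finite) chart set \<Rightarrow> ('a \<Rightarrow> real^'n::finite) \<Rightarrow> ('a \<Rightarrow> (complex^'n) set) \<Rightarrow> bool"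
  where "is_complex_gauss_map A f \<tau> \<longleftrightarrow> kaehler_immersion A f \<and> image_T10_eq A f \<tau>"

definition real_section_N ::
    "('a, 'm::finite) chart set \<Rightarrow> ('a \<Rightarrow> (complex^'n::finite) set) \<Rightarrow> ('a \<Rightarrow> real^'n) \<Rightarrow> bool"
  where "real_section_N A \<tau> f \<longleftrightarrow> smooth_map A f \<and> (\<forall>p. complex_vec (f p) \<in> N_of (\<tau> p))"

end

theory Submission
  imports Defs
begin

text \<open>Let \<open>F\<close> be \<open>f\<close> in a chart. Up to a factor, \<open>dF(T')\<close> consists of the vectors
  \<open>d10 v = dF(v) - i dF(J v)\<close>, and \<open>\<tau>\<close> is described by the Hermitian projection \<open>P\<close> onto it.

  If \<open>f\<close> maps into the unit sphere, then \<open>f\<close> is orthogonal to \<open>df\<close>, and so it is a section of \<open>N\<close>.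

  Conversely, let \<open>f\<close> be a section of \<open>N\<close> with \<open>df(T') = \<tau>'\<close>. Then \<open>f \<bullet> df = 0\<close>, so \<open>|f|\<close> is
  locally constant. It does not vanish, because otherwise \<open>df = 0\<close> on an open set, while
  \<open>\<tau>'\<close> has dimension \<open>m \<ge> 1\<close>. Dividing by \<open>|f|\<close> gives a map into the sphere with the same
  complex Gauss map (\<open>normalized_section\<close>).

  Every \<open>f\<close> with \<open>df(T') = \<tau>'\<close> is a Kaehler immersion with parallel pluri-mean curvature, for the
  following reasons.

  Isotropy of \<open>\<tau>'\<close> makes \<open>J\<close> orthogonal for the induced metric and \<open>df\<close> injective
  (\<open>isotropic\<close>, \<open>inj_pd\<close>). Differentiating \<open>P d10 = d10\<close> and using that \<open>dP\<close> maps \<open>\<tau>'\<close> into \<open>N\<close>,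
  one sees that derivatives of sections of \<open>\<tau>'\<close> stay in \<open>\<tau>' + N\<close>; thus the Levi-Civita connection
  preserves \<open>T'\<close>, that is, \<open>J\<close> is parallel (\<open>horizontal_pd\<close>, \<open>christoffel_J\<close>).

  For a parallel \<open>J\<close> the vector \<open>mixed v w = f\<^sub>v\<^sub>w + f\<^sub>J\<^sub>v\<^sub>J\<^sub>w\<close> of second derivatives is normal, and
  hence it is twice the \<open>(1,1)\<close> part of the second fundamental form (\<open>mixed_normal\<close>).

  On \<open>T' \<otimes> T''\<close> the Christoffel symbols of every Kaehler metric vanish, so pluriharmonicity of \<open>\<tau>\<close>
  says that \<open>P\<^sub>v\<^sub>w + P\<^sub>J\<^sub>v\<^sub>J\<^sub>w\<close> is orthogonal to the tangent space of \<open>Z\<^sub>1\<close> whatever the given metric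
  on \<open>M\<close> is (\<open>pluriharmonic_chart\<close>). The tangent space contains \<open>y x\<^sup>* + x y\<^sup>*\<close> for \<open>x \<in> \<tau>'\<close>,
  \<open>y \<in> N\<close> (\<open>horizontal_tangent\<close>), so this matrix maps \<open>\<tau>'\<close> into \<open>N\<^sup>\<bottom>\<close> (\<open>normal_to_horizontal\<close>).
  Differentiating \<open>P d10 = d10\<close> twice and taking normal components therefore leaves only first-order
  terms in \<open>P\<close>, which are exactly the Christoffel terms in the covariant derivative of \<open>mixed\<close>
  (\<open>third_derivative_normal\<close>, \<open>pd_mixed_normal\<close>).\<close>

section \<open>Calculus on open sets\<close>

lemma has_derivative_pd: "F differentiable (at x) \<Longrightarrow> (F has_derivative pd F x) (at x)"
  by (simp add: frechet_derivative_works)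

lemma pd_eqI: "(F has_derivative F') (at x) \<Longrightarrow> pd F x = F'"
  by (metis frechet_derivative_at)

lemma pd_linear: "F differentiable (at x) \<Longrightarrow> linear (pd F x)"
  by (rule linear_frechet_derivative)

lemma pd_cong:
  assumes "open S" "x \<in> S" "\<And>y. y \<in> S \<Longrightarrow> F y = G y"
  shows "pd F x = pd G x"
proof -
  have "(F has_derivative D) (at x) \<longleftrightarrow> (G has_derivative D) (at x)" for D
    using has_derivative_transform_within_open[OF _ assms(1,2), of F D UNIV G]
      has_derivative_transform_within_open[OF _ assms(1,2), of G D UNIV F] assms(3) by auto
  then show ?thesis by (simp add: frechet_derivative_def)
qed

lemma differentiable_cong_open:
  assumes "open S" "x \<in> S" "\<And>y. y \<in> S \<Longrightarrow> F y = G y" "F differentiable (at x)"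
  shows "G differentiable (at x)"
  using assms has_derivative_transform_within_open[of F _ x UNIV S G] unfolding differentiable_def
  by blast

lemma k_smooth_on_cong:
  assumes "open S" "\<And>x. x \<in> S \<Longrightarrow> F x = G x" "k_smooth_on k S F"
  shows "k_smooth_on k S G"
  using assms(2,3)
proof (induction k arbitrary: F G)
  case 0
  then show ?case using continuous_on_cong[of S S F G] by simp
next
  case (Suc k)
  have "k_smooth_on k S (\<lambda>x. pd G x v)" for v
    using Suc.IH[of "\<lambda>x. pd F x v" "\<lambda>x. pd G x v"] Suc.prems pd_cong[OF assms(1), of _ F G]
    by simp
  then show ?case
    using Suc.prems differentiable_cong_open[OF assms(1), of _ F G] by auto
qed

lemma smooth_on_differentiable: "smooth_on S F \<Longrightarrow> x \<in> S \<Longrightarrow> F differentiable (at x)"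
  unfolding smooth_on_def by (metis k_smooth_on.simps(2))

lemma smooth_on_pd: "smooth_on S F \<Longrightarrow> smooth_on S (\<lambda>x. pd F x v)"
  unfolding smooth_on_def by (metis k_smooth_on.simps(2))

lemma pd_bounded_linear:
  assumes "bounded_linear L" "F differentiable (at x)"
  shows "pd (\<lambda>y. L (F y)) x v = L (pd F x v)"
  using pd_eqI[OF bounded_linear.has_derivative[OF assms(1) has_derivative_pd[OF assms(2)]]]
  by simp

lemma differentiable_bounded_linear:
  assumes "bounded_linear L" "F differentiable (at x)"
  shows "(\<lambda>y. L (F y)) differentiable (at x)"
  using bounded_linear.has_derivative[OF assms(1) has_derivative_pd[OF assms(2)]]
  unfolding differentiable_def by blast

lemma pd_in_kernel:
  assumes "open S" "x \<in> S" "bounded_linear L" "F differentiable (at x)" "\<And>y. y \<in> S \<Longrightarrow> L (F y) = 0"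
  shows "L (pd F x v) = 0"
proof -
  have "pd (\<lambda>y. L (F y)) x v = pd (\<lambda>y. 0) x v"
    by (rule fun_cong[OF pd_cong[OF assms(1,2)]]) (rule assms(5))
  then show ?thesis by (simp add: pd_bounded_linear[OF assms(3,4)])
qed

lemma differentiable_bounded_bilinear:
  assumes "bounded_bilinear B" "F differentiable (at x)" "G differentiable (at x)"
  shows "(\<lambda>y. B (F y) (G y)) differentiable (at x)"
  using bounded_bilinear.FDERIV[OF assms(1) has_derivative_pd[OF assms(2)] has_derivative_pd[OF assms(3)]]
  unfolding differentiable_def by blast

lemma pd_bounded_bilinear:
  assumes "bounded_bilinear B" "F differentiable (at x)" "G differentiable (at x)"
  shows "pd (\<lambda>y. B (F y) (G y)) x v = B (F x) (pd G x v) + B (pd F x v) (G x)"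
  using pd_eqI[OF bounded_bilinear.FDERIV[OF assms(1) has_derivative_pd[OF assms(2)]
        has_derivative_pd[OF assms(3)]]]
  by simp

text \<open>For a constant family \<open>L\<close> this is composition with a linear map; the locally constant case serves to
  normalize a section whose length is constant only on each component of the manifold.\<close>

lemma k_smooth_on_locally_constant_linear:
  assumes "open S" and lin: "\<And>x. x \<in> S \<Longrightarrow> bounded_linear (L x)"
    and loc: "\<And>x. x \<in> S \<Longrightarrow> \<exists>V. open V \<and> x \<in> V \<and> (\<forall>y\<in>V. L y = L x)"
    and "k_smooth_on k S F"
  shows "k_smooth_on k S (\<lambda>x. L x (F x))"
  using assms(4)
proof (induction k arbitrary: F)
  case 0
  have "isCont (\<lambda>x. L x (F x)) x" if x: "x \<in> S" for x
  proof -
    obtain V where V: "open V" "x \<in> V" "\<And>y. y \<in> V \<Longrightarrow> L y = L x" using loc[OF x] by blast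
    have "isCont F x" using 0 x assms(1) by (simp add: continuous_on_eq_continuous_at)
    then have "isCont (\<lambda>y. L x (F y)) x" by (rule bounded_linear.isCont[OF lin[OF x]])
    moreover have "L x (F y) = L y (F y)" if "y \<in> V" for y using V(3)[OF that] by simp
    then have "\<forall>\<^sub>F y in nhds x. L x (F y) = L y (F y)"
      unfolding eventually_nhds using V(1,2) by blast
    ultimately show ?thesis by (rule iffD1[OF isCont_cong, rotated])
  qed
  then show ?case using assms(1) by (simp add: continuous_on_eq_continuous_at)
next
  case (Suc k)
  have D: "((\<lambda>x. L x (F x)) has_derivative (\<lambda>v. L x (pd F x v))) (at x)" if x: "x \<in> S" for x
  proof -
    obtain V where V: "open V" "x \<in> V" "\<And>y. y \<in> V \<Longrightarrow> L y = L x" using loc[OF x] by blast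
    have "((\<lambda>y. L x (F y)) has_derivative (\<lambda>v. L x (pd F x v))) (at x)"
      using Suc.prems x by (intro bounded_linear.has_derivative[OF lin[OF x]] has_derivative_pd) simp
    then show ?thesis
      by (rule has_derivative_transform_within_open[OF _ V(1,2)]) (simp add: V(3))
  qed
  have "k_smooth_on k S (\<lambda>x. pd (\<lambda>y. L y (F y)) x v)" for v
  proof (rule k_smooth_on_cong[OF assms(1)])
    show "k_smooth_on k S (\<lambda>x. L x (pd F x v))" using Suc by simp
    show "L x (pd F x v) = pd (\<lambda>y. L y (F y)) x v" if "x \<in> S" for x
      using pd_eqI[OF D[OF that]] by simp
  qed
  then show ?case using D unfolding k_smooth_on.simps differentiable_def by blast
qed

text \<open>Apply the mean value theorem to the second difference, first along \<open>v\<close> and then along \<open>w\<close>: the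
  quotient is a value of the second derivative at an intermediate point.\<close>

lemma second_difference_quotient:
  fixes \<phi> :: "'e::real_normed_vector \<Rightarrow> real"
  assumes "open S" "x \<in> S" "k_smooth_on 2 S \<phi>" "e > 0"
  shows "\<exists>d>0. \<forall>t. 0 < t \<and> t < d \<longrightarrow>
    \<bar>(\<phi> (x + t *\<^sub>R v + t *\<^sub>R w) - \<phi> (x + t *\<^sub>R v) - \<phi> (x + t *\<^sub>R w) + \<phi> x) / t\<^sup>2
      - pd (\<lambda>y. pd \<phi> y v) x w\<bar> < e"
proof -
  define H where "H = (\<lambda>y. pd (\<lambda>y. pd \<phi> y v) y w)"
  have d1: "\<phi> differentiable (at y)" if "y \<in> S" for y
    using assms(3) that by (simp add: numeral_2_eq_2)
  have d2: "(\<lambda>y. pd \<phi> y v) differentiable (at y)" if "y \<in> S" for y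
    using assms(3) that by (simp add: numeral_2_eq_2)
  have "continuous_on S H" using assms(3) by (simp add: numeral_2_eq_2 H_def)
  then have "isCont H x" using assms(1,2) by (simp add: continuous_on_eq_continuous_at)
  then obtain d0 where d0: "d0 > 0" "\<And>y. dist y x < d0 \<Longrightarrow> \<bar>H y - H x\<bar> < e"
    using assms(4) unfolding continuous_at_eps_delta dist_real_def by blast
  obtain r where r: "r > 0" "ball x r \<subseteq> S" using assms(1,2) openE by blast
  \<comment> \<open>\<open>t K\<close> bounds the displacements \<open>s v + q w\<close> with \<open>s, q \<le> t\<close>.\<close>
  define K where "K = norm v + norm w + 1"
  have K: "K > 0" by (simp add: K_def add_nonneg_pos)
  define d where "d = min d0 r / K"
  have near: "dist (x + s *\<^sub>R v + q *\<^sub>R w) x < min d0 r"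
    if "0 \<le> s" "s \<le> t" "0 \<le> q" "q \<le> t" "0 < t" "t < d" for s q t
  proof -
    have "norm (s *\<^sub>R v + q *\<^sub>R w) \<le> s * norm v + q * norm w"
      using norm_triangle_ineq[of "s *\<^sub>R v" "q *\<^sub>R w"] that by simp
    also have "\<dots> \<le> t * norm v + t * norm w"
      using that by (intro add_mono mult_right_mono) auto
    also have "\<dots> \<le> t * K" using that by (simp add: K_def algebra_simps)
    also have "\<dots> < min d0 r" using that K by (simp add: d_def field_simps)
    finally show ?thesis by (simp add: dist_norm add.assoc)
  qed
  have inS: "x + s *\<^sub>R v + q *\<^sub>R w \<in> S"
    if "0 \<le> s" "s \<le> t" "0 \<le> q" "q \<le> t" "0 < t" "t < d" for s q t
    using near[OF that] r(2) by (auto simp: dist_commute)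
  have "\<bar>(\<phi> (x + t *\<^sub>R v + t *\<^sub>R w) - \<phi> (x + t *\<^sub>R v) - \<phi> (x + t *\<^sub>R w) + \<phi> x) / t\<^sup>2 - H x\<bar> < e"
    if t: "0 < t" "t < d" for t
  proof -
    have a: "((\<lambda>s. \<phi> (x + s *\<^sub>R v + q *\<^sub>R w)) has_real_derivative
        pd \<phi> (x + s *\<^sub>R v + q *\<^sub>R w) v) (at s)"
      if "0 \<le> s" "s \<le> t" "0 \<le> q" "q \<le> t" for s q
    proof -
      have 1: "((\<lambda>s. x + s *\<^sub>R v + q *\<^sub>R w) has_derivative (\<lambda>h. h *\<^sub>R v)) (at s)"
        by (auto intro!: derivative_eq_intros)
      have 2: "(\<phi> has_derivative pd \<phi> (x + s *\<^sub>R v + q *\<^sub>R w)) (at (x + s *\<^sub>R v + q *\<^sub>R w))"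
        by (intro has_derivative_pd d1 inS[of _ t]) (use that t in auto)
      show ?thesis
        using has_derivative_compose[OF 1 2] linear_cmul[OF has_derivative_linear[OF 2]]
        by (simp add: has_field_derivative_def mult.commute[of _ "pd _ _ _"] )
    qed
    have "\<exists>s>0. s < t \<and>
       (\<phi> (x + t *\<^sub>R v + t *\<^sub>R w) - \<phi> (x + t *\<^sub>R v + 0 *\<^sub>R w)) - (\<phi> (x + 0 *\<^sub>R v + t *\<^sub>R w) - \<phi> (x + 0 *\<^sub>R v + 0 *\<^sub>R w))
       = (t - 0) * (pd \<phi> (x + s *\<^sub>R v + t *\<^sub>R w) v - pd \<phi> (x + s *\<^sub>R v + 0 *\<^sub>R w) v)"
      using t by (intro MVT2[of 0 t "\<lambda>s. \<phi> (x + s *\<^sub>R v + t *\<^sub>R w) - \<phi> (x + s *\<^sub>R v + 0 *\<^sub>R w)"] DERIV_diff a) auto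
    then obtain s where s: "0 < s" "s < t"
       "\<phi> (x + t *\<^sub>R v + t *\<^sub>R w) - \<phi> (x + t *\<^sub>R v) - \<phi> (x + t *\<^sub>R w) + \<phi> x
       = t * (pd \<phi> (x + s *\<^sub>R v + t *\<^sub>R w) v - pd \<phi> (x + s *\<^sub>R v + 0 *\<^sub>R w) v)"
      by (auto simp: algebra_simps)
    have b: "((\<lambda>q. pd \<phi> (x + s *\<^sub>R v + q *\<^sub>R w) v) has_real_derivative
        H (x + s *\<^sub>R v + q *\<^sub>R w)) (at q)"
      if "0 \<le> q" "q \<le> t" for q
    proof -
      have 1: "((\<lambda>q. x + s *\<^sub>R v + q *\<^sub>R w) has_derivative (\<lambda>h. h *\<^sub>R w)) (at q)"
        by (auto intro!: derivative_eq_intros)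
      have 2: "((\<lambda>y. pd \<phi> y v) has_derivative pd (\<lambda>y. pd \<phi> y v) (x + s *\<^sub>R v + q *\<^sub>R w))
          (at (x + s *\<^sub>R v + q *\<^sub>R w))"
        by (intro has_derivative_pd d2 inS[of _ t]) (use that t s in auto)
      show ?thesis
        using has_derivative_compose[OF 1 2] linear_cmul[OF has_derivative_linear[OF 2]]
        by (simp add: has_field_derivative_def H_def mult.commute[of _ "pd _ _ _"])
    qed
    obtain q where q: "0 < q" "q < t"
      "pd \<phi> (x + s *\<^sub>R v + t *\<^sub>R w) v - pd \<phi> (x + s *\<^sub>R v + 0 *\<^sub>R w) v
        = (t - 0) * H (x + s *\<^sub>R v + q *\<^sub>R w)"
      using MVT2[of 0 t "\<lambda>q. pd \<phi> (x + s *\<^sub>R v + q *\<^sub>R w) v" "\<lambda>q. H (x + s *\<^sub>R v + q *\<^sub>R w)"] b t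
      by blast
    have "(\<phi> (x + t *\<^sub>R v + t *\<^sub>R w) - \<phi> (x + t *\<^sub>R v) - \<phi> (x + t *\<^sub>R w) + \<phi> x) / t\<^sup>2
        = H (x + s *\<^sub>R v + q *\<^sub>R w)"
      unfolding s(3) q(3) using t by (simp add: power2_eq_square)
    then show ?thesis using d0(2) near[of s t q] s q t by simp
  qed
  moreover have "d > 0" using d0 r K by (simp add: d_def)
  ultimately show ?thesis unfolding H_def by blast
qed

text \<open>The second difference is symmetric in \<open>v\<close> and \<open>w\<close>, and its quotient tends to either of the two
  mixed derivatives.\<close>

lemma pd_commute_real:
  fixes \<phi> :: "'e::real_normed_vector \<Rightarrow> real"
  assumes "open S" "x \<in> S" "k_smooth_on 2 S \<phi>"
  shows "pd (\<lambda>y. pd \<phi> y v) x w = pd (\<lambda>y. pd \<phi> y w) x v"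
proof (rule ccontr)
  assume ne: "pd (\<lambda>y. pd \<phi> y v) x w \<noteq> pd (\<lambda>y. pd \<phi> y w) x v" (is "?a \<noteq> ?b")
  define e where "e = \<bar>?a - ?b\<bar> / 2"
  have e: "e > 0" using ne by (simp add: e_def)
  define q where "q t v w = (\<phi> (x + t *\<^sub>R v + t *\<^sub>R w) - \<phi> (x + t *\<^sub>R v) - \<phi> (x + t *\<^sub>R w) + \<phi> x) / t\<^sup>2"
    for t v w
  have sym: "q t v w = q t w v" for t by (simp add: q_def algebra_simps)
  obtain d1 where d1: "d1 > 0" "\<And>t. 0 < t \<Longrightarrow> t < d1 \<Longrightarrow> \<bar>q t v w - ?a\<bar> < e"
    using second_difference_quotient[OF assms e, of v w] unfolding q_def by blast
  obtain d2 where d2: "d2 > 0" "\<And>t. 0 < t \<Longrightarrow> t < d2 \<Longrightarrow> \<bar>q t w v - ?b\<bar> < e"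
    using second_difference_quotient[OF assms e, of w v] unfolding q_def by blast
  define t where "t = min d1 d2 / 2"
  have "\<bar>q t v w - ?a\<bar> < e" "\<bar>q t v w - ?b\<bar> < e"
    using d1(1) d2(1) d1(2)[of t] d2(2)[of t] sym by (auto simp: t_def)
  then have "\<bar>?a - ?b\<bar> < 2 * e" by linarith
  then show False by (simp add: e_def)
qed

lemma pd_commute:
  fixes F :: "'e::real_normed_vector \<Rightarrow> 'b::euclidean_space"
  assumes "open S" "x \<in> S" "smooth_on S F"
  shows "pd (\<lambda>y. pd F y v) x w = pd (\<lambda>y. pd F y w) x v"
proof (rule euclidean_eqI)
  fix b :: 'b assume "b \<in> Basis"
  have *: "pd (\<lambda>y. pd F y v) x w \<bullet> b = pd (\<lambda>y. pd (\<lambda>z. F z \<bullet> b) y v) x w" for v w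
  proof -
    have "pd (\<lambda>y. pd F y v) x w \<bullet> b = pd (\<lambda>y. pd F y v \<bullet> b) x w"
      using smooth_on_differentiable[OF smooth_on_pd[OF assms(3)] assms(2)]
      by (simp add: pd_bounded_linear[OF bounded_linear_inner_left])
    also have "\<dots> = pd (\<lambda>y. pd (\<lambda>z. F z \<bullet> b) y v) x w"
      using smooth_on_differentiable[OF assms(3)]
      by (intro arg_cong2[of _ _ _ _ "\<lambda>f a. f a", OF pd_cong[OF assms(1,2)] refl])
        (simp add: pd_bounded_linear[OF bounded_linear_inner_left])
    finally show ?thesis .
  qed
  have "k_smooth_on 2 S (\<lambda>z. F z \<bullet> b)"
    using k_smooth_on_locally_constant_linear[OF assms(1), of "\<lambda>_ z. z \<bullet> b" 2 F] assms(3)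
    unfolding smooth_on_def by (auto intro: bounded_linear_inner_left)
  then show "pd (\<lambda>y. pd F y v) x w \<bullet> b = pd (\<lambda>y. pd F y w) x v \<bullet> b"
    unfolding * by (rule pd_commute_real[OF assms(1,2)])
qed

section \<open>Hermitian linear algebra\<close>

abbreviation vconj :: "complex^'n \<Rightarrow> complex^'n"
  where "vconj x \<equiv> (\<chi> j. cnj (x $ j))"

lemma herm_left [simp]:
  "herm (x + y) z = herm x z + herm y z" "herm (x - y) z = herm x z - herm y z"
  "herm (a *s x) z = a * herm x z" "herm (- x) z = - herm x z" "herm 0 z = 0"
  by (simp_all add: herm_def algebra_simps sum.distrib sum_subtractf sum_distrib_left sum_negf)

lemma herm_right [simp]:
  "herm z (x + y) = herm z x + herm z y" "herm z (x - y) = herm z x - herm z y"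
  "herm z (a *s x) = cnj a * herm z x" "herm z (- x) = - herm z x" "herm z 0 = 0"
  by (simp_all add: herm_def algebra_simps sum.distrib sum_subtractf sum_distrib_left sum_negf)

lemma herm_commute: "herm x y = cnj (herm y x)"
  by (simp add: herm_def mult.commute)

lemma bil_eq_herm: "bil x y = herm x (vconj y)"
  by (simp add: herm_def bil_def)

lemma inner_eq_Re_herm: "x \<bullet> y = Re (herm x y)"
  by (simp add: inner_vec_def herm_def inner_complex_def)

lemma herm_self: "herm x x = of_real (x \<bullet> x)"
  unfolding herm_def inner_vec_def of_real_sum
  by (intro sum.cong refl complex_eqI) (simp_all add: inner_complex_def)

lemma herm_self_eq_0: "herm x x = 0 \<longleftrightarrow> x = 0"
  by (simp add: herm_self)

lemma herm_perp_commute: "z \<in> herm_perp S \<Longrightarrow> x \<in> S \<Longrightarrow> herm x z = 0"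
  using herm_commute[of z x] by (simp add: herm_perp_def)

lemma subspace_herm_perp: "vec.subspace (herm_perp S)"
  by (auto simp: vec.subspace_def herm_perp_def)

lemma N_of_iff:
  assumes "vec.subspace E"
  shows "z \<in> N_of E \<longleftrightarrow> (\<forall>x\<in>E. herm z x = 0 \<and> bil z x = 0)"
proof -
  let ?S = "{x + y | x y. x \<in> E \<and> y \<in> conj_space E}"
  have N: "z \<in> N_of E \<longleftrightarrow> (\<forall>x\<in>E. \<forall>y\<in>E. herm z (x + vconj y) = 0)"
    by (auto simp: N_of_def herm_perp_def conj_space_def simp del: herm_right)
  have "vconj 0 = (0 :: complex^'a)" by (simp add: vec_eq_iff)
  then show ?thesis
    unfolding N bil_eq_herm herm_right(1)
    using vec.subspace_0[OF assms] by (metis add.left_neutral add.right_neutral herm_right(5))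
qed

lemma subspace_N_of: "vec.subspace (N_of E)"
  unfolding N_of_def by (rule subspace_herm_perp)

lemma scaleR_complex_vec: "c *\<^sub>R x = complex_of_real c *s (x :: complex^'n)"
  by (simp add: vec_eq_iff scaleR_conv_of_real[where 'a = complex])

lemma subspace_complex_imp_real: "vec.subspace E \<Longrightarrow> subspace (E :: (complex^'n) set)"
  by (simp add: scaleR_complex_vec vec.subspace_def subspace_def)

text \<open>The real orthogonal complement of a complex subspace is also its Hermitian complement: the real part
  of \<open>herm z (\<i> w)\<close> is the imaginary part of \<open>herm z w\<close>.\<close>

lemma herm_decomposition:
  assumes "vec.subspace E"
  obtains y where "y \<in> E" "x - y \<in> herm_perp E"
proof -
  have E: "span E = E" using subspace_complex_imp_real[OF assms] by simp
  obtain y z where yz: "y \<in> E" "\<And>w. w \<in> E \<Longrightarrow> orthogonal z w" "x = y + z"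
    using orthogonal_subspace_decomp_exists[of E x] unfolding E by metis
  have "herm z w = 0" if w: "w \<in> E" for w
  proof (rule complex_eqI)
    have "Re (herm z (\<i> *s w)) = 0" "Re (herm z w) = 0"
      using yz(2)[OF vec.subspace_scale[OF assms w, of \<i>]] yz(2)[OF w]
      by (simp_all only: orthogonal_def inner_eq_Re_herm)
    then show "Re (herm z w) = Re 0" "Im (herm z w) = Im 0" by simp_all
  qed
  then show ?thesis using that[of y] yz by (simp add: herm_perp_def)
qed

definition is_herm_proj :: "(complex^'n::finite) set \<Rightarrow> complex^'n^'n \<Rightarrow> bool"
  where "is_herm_proj E P \<longleftrightarrow> (\<forall>x. P *v x \<in> E \<and> x - P *v x \<in> herm_perp E)"

lemma herm_decomposition_unique:
  assumes "vec.subspace E" "y \<in> E" "x - y \<in> herm_perp E" "z \<in> E" "x - z \<in> herm_perp E"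
  shows "y = z"
proof -
  have "y - z \<in> E" using vec.subspace_diff[OF assms(1)] assms by blast
  moreover have "herm w (y - z) = 0" if "w \<in> E" for w
    using herm_perp_commute[OF assms(3) that] herm_perp_commute[OF assms(5) that] by simp
  ultimately have "herm (y - z) (y - z) = 0" by blast
  then have "y - z = 0" by (rule iffD1[OF herm_self_eq_0])
  then show ?thesis by simp
qed

lemma is_herm_proj_unique:
  assumes "vec.subspace E" "is_herm_proj E P" "is_herm_proj E Q"
  shows "P = Q"
proof -
  have "P *v x = Q *v x" for x
    using assms(2,3) unfolding is_herm_proj_def
    by (intro herm_decomposition_unique[OF assms(1), of _ x]) blast+
  then show ?thesis unfolding matrix_eq by blast
qed

lemma proj_mat_eq:
  assumes "vec.subspace E" "is_herm_proj E P"
  shows "proj_mat E = P"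
proof -
  have "proj_mat E = (THE Q. is_herm_proj E Q)"
    unfolding proj_mat_def is_herm_proj_def ..
  also have "\<dots> = P" using assms(2) is_herm_proj_unique[OF assms(1) _ assms(2)] by (rule the_equality)
  finally show ?thesis .
qed

lemma is_herm_proj_proj_mat:
  assumes "vec.subspace E"
  shows "is_herm_proj E (proj_mat E)"
proof -
  have "\<forall>x. \<exists>y. y \<in> E \<and> x - y \<in> herm_perp E" using herm_decomposition[OF assms] by blast
  then obtain \<pi> where \<pi>: "\<And>x. \<pi> x \<in> E" "\<And>x. x - \<pi> x \<in> herm_perp E" by metis
  have "\<pi> (x + y) = \<pi> x + \<pi> y" for x y
    using vec.subspace_add[OF subspace_herm_perp \<pi>(2)[of x] \<pi>(2)[of y]]
      vec.subspace_add[OF assms \<pi>(1)[of x] \<pi>(1)[of y]]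
    by (intro herm_decomposition_unique[OF assms \<pi>(1,2)]) (simp_all add: algebra_simps)
  moreover have "\<pi> (c *s x) = c *s \<pi> x" for c x
    using vec.subspace_scale[OF subspace_herm_perp \<pi>(2)[of x], of c]
      vec.subspace_scale[OF assms \<pi>(1)[of x], of c]
    by (intro herm_decomposition_unique[OF assms \<pi>(1,2)])
      (simp_all add: vec.scale_right_diff_distrib)
  ultimately have "Vector_Spaces.linear (*s) (*s) \<pi>" by unfold_locales auto
  then have "is_herm_proj E (matrix \<pi>)"
    using \<pi> by (simp add: is_herm_proj_def matrix_works)
  then show ?thesis by (simp add: proj_mat_eq[OF assms])
qed

context
  fixes E :: "(complex^'n::finite) set" and P :: "complex^'n^'n"
  assumes E: "vec.subspace E" and P: "is_herm_proj E P"
begin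

lemma herm_proj_in: "P *v x \<in> E"
  using P by (simp add: is_herm_proj_def)

lemma herm_proj_id: "x \<in> E \<Longrightarrow> P *v x = x"
  using P vec.subspace_0[OF subspace_herm_perp[of E]]
  by (intro herm_decomposition_unique[OF E, of _ x]) (auto simp: is_herm_proj_def)

lemma herm_proj_0: "x \<in> herm_perp E \<Longrightarrow> P *v x = 0"
  using P vec.subspace_0[OF E]
  by (intro herm_decomposition_unique[OF E, of _ x]) (auto simp: is_herm_proj_def)

lemma herm_proj_herm:
  assumes "e \<in> E"
  shows "herm (P *v x) e = herm x e"
proof -
  have "herm (x - P *v x) e = 0"
    using P assms unfolding is_herm_proj_def herm_perp_def by blast
  then show ?thesis by simp
qed

lemma herm_proj_self_adjoint: "herm (P *v x) y = herm x (P *v y)"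
proof -
  have "herm (P *v x) y = cnj (herm y (P *v x))" by (rule herm_commute)
  also have "herm y (P *v x) = herm (P *v y) (P *v x)"
    using herm_proj_herm[OF herm_proj_in] by simp
  also have "cnj \<dots> = herm (P *v x) (P *v y)" by (rule herm_commute[symmetric])
  also have "\<dots> = herm x (P *v y)" by (rule herm_proj_herm[OF herm_proj_in])
  finally show ?thesis .
qed

end

section \<open>Horizontal tangent vectors\<close>

text \<open>The rank-one matrix \<open>y x\<^sup>*\<close>.\<close>

definition outer :: "complex^'n::finite \<Rightarrow> complex^'n \<Rightarrow> complex^'n^'n"
  where "outer y x = (\<chi> i j. y $ i * cnj (x $ j))"

lemma outer_mult: "outer y x *v z = herm z x *s y"
  by (simp add: vec_eq_iff outer_def matrix_vector_mult_def herm_def sum_distrib_left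
      sum_distrib_right mult_ac)

lemma bounded_bilinear_outer: "bounded_bilinear outer"
proof -
  have "bilinear outer"
    by (simp add: bilinear_def linear_iff vec_eq_iff outer_def algebra_simps scaleR_conv_of_real[where 'a = complex])
  then show ?thesis by (simp add: bilinear_conv_bounded_bilinear)
qed

lemma inner_outer: "M \<bullet> outer y x = Re (herm (M *v x) y)"
  by (simp add: inner_vec_def outer_def herm_def matrix_vector_mult_def inner_complex_def
      sum_distrib_right sum_distrib_left mult_ac algebra_simps sum_subtractf sum.distrib)

lemma bil_simps [simp]:
  "bil (x + y) z = bil x z + bil y z" "bil (x - y) z = bil x z - bil y z"
  "bil (a *s x) z = a * bil x z"
  "bil z (x + y) = bil z x + bil z y" "bil z (x - y) = bil z x - bil z y"
  "bil z (a *s x) = a * bil z x"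
  by (simp_all add: bil_def algebra_simps sum.distrib sum_subtractf sum_distrib_left)

lemma bil_commute: "bil x y = bil y x"
  by (simp add: bil_def mult.commute)

lemma bil_vconj: "bil x (vconj y) = herm x y"
  by (simp add: herm_def bil_def)

text \<open>The curve consists of the subspaces obtained from \<open>E\<close> by moving the unit vector \<open>x\<close> along
  \<open>X t = x + t y - (t\<^sup>2/2) bil(y, y) conj x\<close> and keeping its complement in \<open>E\<close>. The quadratic term
  makes \<open>X t\<close> isotropic, since \<open>bil(x, conj x) = 1\<close>; and \<open>X t\<close> stays orthogonal, for both forms, to the
  complement of \<open>x\<close> in \<open>E\<close>, because \<open>y \<in> N\<close> and \<open>E\<close> is isotropic. The projection therefore changes only
  by the summand of \<open>X t\<close>.\<close>

lemma horizontal_tangent: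
  fixes E :: "(complex^'n::finite) set"
  assumes E: "E \<in> Z1 m" and x: "x \<in> E" "herm x x = 1" and y: "y \<in> N_of E"
  shows "outer y x + outer x y \<in> tangent_space (proj_mat ` Z1 m) (proj_mat E)"
proof -
  have sub: "vec.subspace E" and iso: "\<And>a b. a \<in> E \<Longrightarrow> b \<in> E \<Longrightarrow> bil a b = 0" and dim: "vec.dim E = m"
    using E by (auto simp: Z1_def)
  have yE: "herm y e = 0" "bil y e = 0" "herm e y = 0" "bil e y = 0" if "e \<in> E" for e
    using y that N_of_iff[OF sub] herm_commute[of y e] bil_commute[of y e]
    by auto
  have ex: "herm e (vconj x) = 0" "herm (vconj x) e = 0" if "e \<in> E" for e
    using iso[OF that x(1)] herm_commute[of "vconj x" e] bil_eq_herm by (metis complex_cnj_zero)+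
  have yx: "herm y (vconj x) = 0" "herm (vconj x) y = 0" "bil y (vconj x) = 0" "bil (vconj x) y = 0"
     "bil (vconj x) (vconj x) = 0"
    using yE[OF x(1)] herm_commute[of "vconj x" y]  bil_eq_herm[of y x] bil_vconj[of y x] bil_commute[of "vconj x" y] iso[OF x(1) x(1)]
     bil_vconj[of "vconj x" x] ex x by auto
  define P where "P = proj_mat E"
  have P: "is_herm_proj E P" unfolding P_def by (rule is_herm_proj_proj_mat[OF sub])
  define q where "q = bil y y"
  define z where "z t = complex_of_real t *s y - (complex_of_real t ^ 2 / 2 * q) *s vconj x" for t
  define X where "X t = x + z t" for t
  define E' where "E' t = (\<lambda>e. e + herm e x *s z t) ` E" for t
  define P' where "P' t = P - outer x x + (1 / (X t \<bullet> X t)) *\<^sub>R outer (X t) (X t)" for t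
  have zx: "herm (z t) e = 0" "herm e (z t) = 0" if "e \<in> E" for e t
    using that by (simp_all add: z_def yE ex)
  have Xx: "herm (X t) x = 1" for t using x zx by (simp add: X_def)
  then have X0: "X t \<noteq> 0" for t by (metis herm_left(5) zero_neq_one)
  have lin: "Vector_Spaces.linear (*s) (*s) (\<lambda>e. e + herm e x *s z t)" for t
    by unfold_locales (auto simp: vec_eq_iff algebra_simps)
  have "inj_on (\<lambda>e. e + herm e x *s z t) E" for t
  proof (rule inj_onI)
    fix a b assume ab: "a \<in> E" "b \<in> E" "a + herm a x *s z t = b + herm b x *s z t"
    define d where "d = a - b"
    have d: "d \<in> E" unfolding d_def by (rule vec.subspace_diff[OF sub ab(1,2)])
    have "herm (a + herm a x *s z t) d = herm (b + herm b x *s z t) d" using ab(3) by simp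
    then have "herm (a - b) d = 0" using zx(1)[OF d] by simp
    then have "herm (a - b) (a - b) = 0" unfolding d_def .
    then have "a - b = 0" by (rule iffD1[OF herm_self_eq_0])
    then show "a = b" by simp
  qed
  then have "vec.dim (E' t) = m" for t
    unfolding E'_def using vec.dim_image_eq[OF lin, where S = E] dim vec.span_eq_iff[THEN iffD2, OF sub]
    by simp
  moreover have sub': "vec.subspace (E' t)" for t
    unfolding E'_def using vec.linear_subspace_image[OF lin sub] .
  moreover have "bil (a + herm a x *s z t) (b + herm b x *s z t) = 0" if "a \<in> E" "b \<in> E" for a b t
    using that by (simp add: z_def iso yE yE[OF x(1)] ex[OF x(1)] yx bil_vconj bil_commute[of "vconj x" a] bil_commute[of "vconj x" b] q_def[symmetric]
        herm_commute[of x] power2_eq_square algebra_simps)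
  ultimately have Z: "E' t \<in> Z1 m" for t by (auto simp: Z1_def E'_def)
  have "is_herm_proj (E' t) (P' t)" for t
    unfolding is_herm_proj_def
  proof (intro allI conjI)
    fix u
    define e0 where "e0 = P *v u - herm u x *s x"
    define c where "c = herm u (X t) / (X t \<bullet> X t)"
    have e0: "e0 \<in> E" unfolding e0_def
      using herm_proj_in[OF sub P] x vec.subspace_diff[OF sub] vec.subspace_scale[OF sub] by blast
    have e0x: "herm e0 x = 0" using herm_proj_herm[OF sub P x(1)] x by (simp add: e0_def)
    have P'u: "P' t *v u = e0 + c *s X t"
      by (simp add: P'_def matrix_vector_mult_add_rdistrib matrix_vector_mult_diff_rdistrib outer_mult
          bounded_bilinear.scaleR_left[OF bounded_bilinear_outer, symmetric] e0_def c_def scaleR_complex_vec)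
    have "P' t *v u = (e0 + c *s x) + herm (e0 + c *s x) x *s z t"
      unfolding P'u using e0x x by (simp add: X_def vec.scale_right_distrib)
    then show "P' t *v u \<in> E' t" unfolding E'_def
      using e0 x vec.subspace_add[OF sub] vec.subspace_scale[OF sub] by blast
    have "herm (u - P' t *v u) (e + herm e x *s z t) = 0" if e: "e \<in> E" for e
    proof -
      define d where "d = e - herm e x *s x"
      have d: "d \<in> E" unfolding d_def
        using e x vec.subspace_diff[OF sub] vec.subspace_scale[OF sub] by blast
      have dx: "herm d x = 0" "herm x d = 0"
        using x herm_commute[of x d] by (auto simp: d_def)
      have Xd: "herm (X t) d = 0" using dx zx[OF d] by (simp add: X_def)
      have ed: "e + herm e x *s z t = d + herm e x *s X t"
        by (simp add: d_def X_def vec.scale_right_distrib)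
      have "herm (u - P' t *v u) d = 0"
        using herm_proj_herm[OF sub P d, of u] dx Xd by (simp add: P'u e0_def)
      moreover have "herm e0 (X t) = 0" using e0x zx[OF e0] by (simp add: X_def)
      then have "herm (u - P' t *v u) (X t) = 0"
        using X0[of t] by (simp add: P'u c_def herm_self)
      ultimately show ?thesis unfolding ed by simp
    qed
    then show "u - P' t *v u \<in> herm_perp (E' t)" by (auto simp: herm_perp_def E'_def)
  qed
  then have P'S: "P' t \<in> proj_mat ` Z1 m" for t
    using proj_mat_eq[OF sub'] Z by (metis image_eqI)
  have zt: "z t = t *\<^sub>R y - t\<^sup>2 *\<^sub>R ((q / 2) *s vconj x)" for t
    by (simp add: z_def vec_eq_iff scaleR_conv_of_real[where 'a = complex])
  have X: "(X has_derivative (\<lambda>t. t *\<^sub>R y)) (at 0)"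
    unfolding X_def[abs_def] zt by (auto intro!: derivative_eq_intros)
  have X00: "X 0 = x" by (simp add: X_def zt)
  have xx: "x \<bullet> x = 1" "x \<bullet> y = 0" "y \<bullet> x = 0"
    using x yE[OF x(1)] by (simp_all add: inner_eq_Re_herm)
  \<comment> \<open>The length of \<open>X t\<close> is stationary at 0, so normalizing it does not affect the velocity.\<close>
  define \<nu> where "\<nu> t = X t \<bullet> X t" for t
  have \<nu>: "(\<nu> has_derivative (\<lambda>t. 0)) (at 0)" "\<nu> 0 = 1"
    using has_derivative_inner[OF X X] by (simp_all add: X00 xx \<nu>_def[abs_def])
  then have I: "((\<lambda>t. 1 / \<nu> t) has_derivative (\<lambda>t. 0)) (at 0)"
    by (auto intro!: derivative_eq_intros)
  have O: "((\<lambda>t. outer (X t) (X t)) has_derivative (\<lambda>t. outer x (t *\<^sub>R y) + outer (t *\<^sub>R y) x)) (at 0)"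
    using bounded_bilinear.FDERIV[OF bounded_bilinear_outer X X] by (simp add: X00)
  have "(P' has_derivative (\<lambda>t. outer x (t *\<^sub>R y) + outer (t *\<^sub>R y) x)) (at 0)"
    unfolding P'_def[abs_def] \<nu>_def[symmetric]
    using has_derivative_add[OF has_derivative_const[of "P - outer x x"] has_derivative_scaleR[OF I O]]
    by (simp add: X00 \<nu>(2))
  then have "(P' has_vector_derivative (outer y x + outer x y)) (at 0)"
    by (simp add: has_vector_derivative_def bounded_bilinear.scaleR_left[OF bounded_bilinear_outer]
        bounded_bilinear.scaleR_right[OF bounded_bilinear_outer] algebra_simps)
  moreover have "P' 0 = proj_mat E" by (simp add: P'_def X00 xx P_def)
  ultimately show ?thesis unfolding tangent_space_def using P'S by blast
qed

text \<open>Against \<open>y x\<^sup>* + x y\<^sup>*\<close> a self-adjoint \<open>H\<close> has inner product \<open>2 Re \<langle>H x, y\<rangle>\<close>; replacing \<open>y\<close> by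
  \<open>\<i> y\<close> gives the imaginary part.\<close>

lemma normal_to_horizontal:
  fixes E :: "(complex^'n::finite) set"
  assumes E: "E \<in> Z1 m"
    and H: "\<And>a b. herm (H *v a) b = herm a (H *v b)"
    and orth: "\<And>v. v \<in> tangent_space (proj_mat ` Z1 m) (proj_mat E) \<Longrightarrow> H \<bullet> v = 0"
    and x: "x \<in> E" and y: "y \<in> N_of E"
  shows "herm (H *v x) y = 0"
proof (cases "x = 0")
  case False
  have sub: "vec.subspace E" using E by (simp add: Z1_def)
  define c where "c = complex_of_real (1 / norm x)"
  have "c *s x = (1 / norm x) *\<^sub>R x" by (simp add: c_def scaleR_complex_vec)
  then have "herm (c *s x) (c *s x) = 1"
    using False by (simp only: herm_self) (simp add: dot_square_norm power2_eq_square)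
  then have u: "c *s x \<in> E" "herm (c *s x) (c *s x) = 1" "c \<noteq> 0"
    using vec.subspace_scale[OF sub x] False by (simp_all add: c_def)
  have "Re (herm (H *v (c *s x)) w) = 0" if w: "w \<in> N_of E" for w
  proof -
    have "0 = Re (herm (H *v (c *s x)) w) + Re (herm (H *v w) (c *s x))"
      using orth[OF horizontal_tangent[OF E u(1,2) w]] by (simp only: inner_add_right inner_outer)
    also have "herm (H *v w) (c *s x) = cnj (herm (H *v (c *s x)) w)"
      using H[of w "c *s x"] herm_commute[of w "H *v (c *s x)"] by (rule trans)
    finally show ?thesis by simp
  qed
  from this[OF y] this[OF vec.subspace_scale[OF subspace_N_of y, of \<i>]]
  have "herm (H *v (c *s x)) y = 0" by (intro complex_eqI) simp_all
  then show ?thesis using u(3) by (simp add: vec.scale)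
qed simp

section \<open>Orthogonal projections and normal parts\<close>

lemma orth_proj_eqI:
  fixes S :: "'b::euclidean_space set"
  assumes "y \<in> span S" "\<And>z. z \<in> S \<Longrightarrow> (x - y) \<bullet> z = 0"
  shows "orth_proj S x = y"
  unfolding orth_proj_def
proof (rule the_equality)
  fix y' assume y': "y' \<in> span S \<and> (\<forall>z\<in>S. orthogonal (x - y') z)"
  have "(y' - y) \<bullet> z = 0" if "z \<in> S" for z
    using y' assms(2)[OF that] that by (simp add: orthogonal_def inner_diff_left)
  then have "orthogonal (y' - y) z" if "z \<in> span S" for z
    using that by (metis orthogonal_def orthogonal_to_span)
  moreover have "y' - y \<in> span S" using y' assms(1) span_diff by blast
  ultimately show "y' = y" by (metis orthogonal_self right_minus_eq)
qed (use assms in \<open>auto simp: orthogonal_def\<close>)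

lemma orth_proj_exists:
  fixes S :: "'b::euclidean_space set"
  shows "orth_proj S x \<in> span S" "\<And>z. z \<in> S \<Longrightarrow> (x - orth_proj S x) \<bullet> z = 0"
proof -
  obtain y z where *: "y \<in> span S" "\<And>w. w \<in> span S \<Longrightarrow> orthogonal z w" "x = y + z"
    using orthogonal_subspace_decomp_exists[of S x] by metis
  have "orth_proj S x = y"
    using * by (intro orth_proj_eqI) (auto simp: orthogonal_def span_base)
  then show "orth_proj S x \<in> span S" "\<And>z. z \<in> S \<Longrightarrow> (x - orth_proj S x) \<bullet> z = 0"
    using * by (auto simp: orthogonal_def span_base)
qed

lemma orth_proj_add: "orth_proj S (x + y) = orth_proj S x + orth_proj S y"
  using orth_proj_exists[where S = S and x = x] orth_proj_exists[where S = S and x = y]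
  by (intro orth_proj_eqI span_add) (auto simp: inner_diff_left inner_add_left)

lemma normal_part_id:
  fixes S :: "'b::euclidean_space set"
  assumes "\<And>z. z \<in> S \<Longrightarrow> x \<bullet> z = 0"
  shows "normal_part S x = x"
  using orth_proj_eqI[of 0 S x] assms by (simp add: normal_part_def span_zero)

lemma normal_part_orthogonal: "z \<in> S \<Longrightarrow> normal_part S x \<bullet> z = 0"
  unfolding normal_part_def by (rule orth_proj_exists)

lemma normal_part_inner:
  fixes S :: "'b::euclidean_space set"
  assumes "\<And>z. z \<in> S \<Longrightarrow> \<nu> \<bullet> z = 0"
  shows "normal_part S x \<bullet> \<nu> = x \<bullet> \<nu>"
proof -
  have "orthogonal \<nu> (orth_proj S x)"
    using orth_proj_exists(1)[of S x] assms by (metis orthogonal_def orthogonal_to_span)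
  then show ?thesis by (simp add: normal_part_def inner_diff_left orthogonal_def inner_commute[of "orth_proj S x"])
qed

lemma normal_part_add: "normal_part S (x + y) = normal_part S x + normal_part S y"
  by (simp add: normal_part_def orth_proj_add)

lemma normal_part_scaleR: "normal_part S (c *\<^sub>R x) = c *\<^sub>R normal_part S x"
proof -
  have "orth_proj S (c *\<^sub>R x) = c *\<^sub>R orth_proj S x"
    using orth_proj_exists[where S = S and x = x]
    by (intro orth_proj_eqI span_scale) (auto simp flip: scaleR_diff_right)
  then show ?thesis by (simp add: normal_part_def scaleR_diff_right)
qed

section \<open>Complexified derivatives\<close>

lemma J_simps [simp]:
  "J 0 = 0" "J (J v) = - v" "J (v + w) = J v + J w" "J (- v) = - J v" "J (c *\<^sub>R v) = c *\<^sub>R J v"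
  by (simp_all add: J_def vec_eq_iff algebra_simps)

lemma complex_vec_eq: "complex_vec a = to_complex_vec (a, 0)"
  by (simp add: to_complex_vec_def complex_vec_def vec_eq_iff complex_eq_iff)

lemma herm_to_complex_vec:
  "herm (to_complex_vec (a, b)) (to_complex_vec (c, d)) = Complex (a \<bullet> c + b \<bullet> d) (b \<bullet> c - a \<bullet> d)"
  by (simp add: herm_def to_complex_vec_def complex_eq_iff inner_vec_def sum.distrib sum_subtractf
      algebra_simps)

lemma bil_to_complex_vec:
  "bil (to_complex_vec (a, b)) (to_complex_vec (c, d)) = Complex (a \<bullet> c - b \<bullet> d) (a \<bullet> d + b \<bullet> c)"
  by (simp add: bil_def to_complex_vec_def complex_eq_iff inner_vec_def sum.distrib sum_subtractf
      algebra_simps)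

lemma bounded_linear_to_complex_vec: "bounded_linear to_complex_vec"
proof -
  have "linear (to_complex_vec :: (real^'n) \<times> (real^'n) \<Rightarrow> complex^'n)"
    by (simp add: linear_iff to_complex_vec_def vec_eq_iff complex_eq_iff)
  then show ?thesis by (simp add: linear_conv_bounded_linear)
qed

lemma bounded_bilinear_matrix_vector:
  "bounded_bilinear ((*v) :: complex^'n::finite^'n \<Rightarrow> complex^'n \<Rightarrow> complex^'n)"
proof -
  have "bilinear ((*v) :: complex^'n::finite^'n \<Rightarrow> complex^'n \<Rightarrow> complex^'n)"
    by (simp add: bilinear_def linear_iff vec_eq_iff matrix_vector_mult_def algebra_simps
        sum.distrib scaleR_sum_right)
  then show ?thesis by (simp add: bilinear_conv_bounded_bilinear)
qed

lemma T10_eq: "T10 = range (\<lambda>v. (v, - J v))"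
proof -
  have "(a, b) \<in> T10 \<longleftrightarrow> b = - J a" for a b :: "complex^'m"
    unfolding T10_def lin_ext_def mult_i_def by auto
  then show ?thesis by auto
qed

text \<open>The induced metric seen in the coordinates of a single chart.\<close>

definition pullback_metric :: "(complex^'m \<Rightarrow> real^'n) \<Rightarrow> complex^'m \<Rightarrow> complex^'m \<Rightarrow> complex^'m \<Rightarrow> real"
  where "pullback_metric F y v w = pd F y v \<bullet> pd F y w"

section \<open>Immersions with isotropic horizontal Gauss map\<close>

text \<open>The data of one chart: \<open>F\<close> is \<open>f\<close> in coordinates, \<open>E x\<close> is \<open>\<tau>'\<close> at the point with coordinates
  \<open>x\<close>, and \<open>P\<close> is the corresponding field of projections.\<close>

locale isotropic_chart =
  fixes U :: "(complex^'m::finite) set" and F :: "complex^'m \<Rightarrow> real^'n::finite"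
    and E :: "complex^'m \<Rightarrow> (complex^'n) set" and P :: "complex^'m \<Rightarrow> complex^'n^'n"
  assumes openU: "open U" and smooth_F: "smooth_on U F" and smooth_P: "smooth_on U P"
    and Z1: "x \<in> U \<Longrightarrow> E x \<in> Z1 CARD('m)"
    and proj: "x \<in> U \<Longrightarrow> is_herm_proj (E x) (P x)"
    and image: "x \<in> U \<Longrightarrow> (to_complex_vec \<circ> lin_ext (pd F x)) ` T10 = E x"
    and horizontal: "x \<in> U \<Longrightarrow> horizontal_vector (E x) (pd P x v)"
begin

text \<open>The complex linear extension of \<open>dF\<close>, applied to \<open>v - i J v \<in> T'\<close>.\<close>

definition d10 :: "complex^'m \<Rightarrow> complex^'m \<Rightarrow> complex^'n"
  where "d10 v x = to_complex_vec (pd F x v, - pd F x (J v))"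

abbreviation DD :: "complex^'m \<Rightarrow> complex^'m \<Rightarrow> complex^'m \<Rightarrow> real^'n"
  where "DD u v x \<equiv> pd (\<lambda>y. pd F y v) x u"

text \<open>The complex Hessian of \<open>F\<close>: up to a factor, its values on \<open>T' \<otimes> T''\<close>.\<close>

definition mixed :: "complex^'m \<Rightarrow> complex^'m \<Rightarrow> complex^'m \<Rightarrow> real^'n"
  where "mixed v w x = DD v w x + DD (J v) (J w) x"

lemma subspace_E: "x \<in> U \<Longrightarrow> vec.subspace (E x)"
  using Z1 by (simp add: Z1_def)

lemma linear_pd: "x \<in> U \<Longrightarrow> linear (pd F x)"
  by (intro pd_linear smooth_on_differentiable[OF smooth_F])

lemma pd_differentiable: "x \<in> U \<Longrightarrow> (\<lambda>y. pd F y v) differentiable (at x)"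
  by (rule smooth_on_differentiable[OF smooth_on_pd[OF smooth_F]])

lemma DD_differentiable: "x \<in> U \<Longrightarrow> (\<lambda>y. DD w v y) differentiable (at x)"
  by (rule smooth_on_differentiable[OF smooth_on_pd[OF smooth_on_pd[OF smooth_F]]])

lemma pd_linear_simps:
  assumes "x \<in> U"
  shows "pd F x (v + w) = pd F x v + pd F x w" "pd F x (- v) = - pd F x v"
  using linear_pd[OF assms] by (simp_all add: linear_add linear_neg)

lemma DD_commute: "x \<in> U \<Longrightarrow> DD u v x = DD v u x"
  by (rule pd_commute[OF openU _ smooth_F])

lemma E_eq:
  assumes "x \<in> U"
  shows "E x = range (\<lambda>v. d10 v x)"
  using image[OF assms] unfolding T10_eq
  by (auto simp: d10_def lin_ext_def image_image pd_linear_simps[OF assms])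

lemma d10_in: "x \<in> U \<Longrightarrow> d10 v x \<in> E x"
  by (simp add: E_eq)

lemma isotropic:
  assumes "x \<in> U"
  shows "pd F x (J v) \<bullet> pd F x (J w) = pd F x v \<bullet> pd F x w"
proof -
  have "bil (d10 v x) (d10 w x) = 0"
    using Z1[OF assms] d10_in[OF assms] by (simp add: Z1_def)
  then show ?thesis
    by (simp add: d10_def bil_to_complex_vec complex_eq_iff)
qed

lemma d10_linear:
  assumes "x \<in> U"
  shows "Vector_Spaces.linear (*s) (*s) (\<lambda>v. d10 v x)"
proof -
  have sc: "pd F x (c *s v) = Re c *\<^sub>R pd F x v + Im c *\<^sub>R pd F x (J v)" for c v
  proof -
    have "c *s v = Re c *\<^sub>R v + Im c *\<^sub>R J v"
      by (simp add: vec_eq_iff J_def complex_eq_iff)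
    then show ?thesis using linear_pd[OF assms] by (simp add: linear_add linear_scale)
  qed
  have "J (c *s v) = c *s J v" for c and v :: "complex^'m" by (simp add: J_def vec_eq_iff)
  then have "pd F x (J (c *s v)) = Re c *\<^sub>R pd F x (J v) - Im c *\<^sub>R pd F x v" for c v
    by (simp add: sc pd_linear_simps[OF assms])
  then show ?thesis
    by unfold_locales
      (simp_all add: d10_def to_complex_vec_def vec_eq_iff complex_eq_iff pd_linear_simps[OF assms] sc)
qed

text \<open>As \<open>d10\<close> maps onto a space of dimension \<open>m\<close>, it is injective; and isotropy gives
  \<open>|dF(J v)| = |dF(v)|\<close>, so \<open>dF(v) = 0\<close> implies \<open>d10 v = 0\<close>.\<close>

lemma inj_pd:
  assumes "x \<in> U"
  shows "inj (pd F x)"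
proof -
  interpret d10: Vector_Spaces.linear "(*s)" "(*s)" "\<lambda>v. d10 v x" by (rule d10_linear[OF assms])
  let ?B = "cart_basis :: (complex^'m) set" and ?s = "\<lambda>v. d10 v x"
  have fin: "finite ?B" by (rule finite_cart_basis)
  have span: "vec.span (?s ` ?B) = E x"
    using vec.linear_span_image[OF d10_linear[OF assms], of ?B] E_eq[OF assms] by (simp add: span_cart_basis)
  have "CARD('m) = vec.dim (E x)" using Z1[OF assms] by (simp add: Z1_def)
  also have "\<dots> \<le> card (?s ` ?B)"
    using span by (intro vec.dim_le_card) (simp_all add: fin)
  finally have "card ?B \<le> card (?s ` ?B)" by (simp add: card_cart_basis)
  then have card: "card (?s ` ?B) = card ?B" using card_image_le[OF fin, of ?s] by simp
  then have "inj_on ?s ?B" by (rule eq_card_imp_inj_on[OF fin])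
  moreover have "vec.independent (?s ` ?B)"
    using span card Z1[OF assms]
    by (intro vec.card_le_dim_spanning[of _ "E x"])
      (auto simp: Z1_def card_cart_basis fin d10_in[OF assms])
  ultimately have inj: "inj ?s"
    using d10.inj_on_span_independent_image[of ?B] by (simp add: span_cart_basis)
  have "v = 0" if "pd F x v = 0" for v
  proof -
    have "pd F x (J v) = 0" using isotropic[OF assms, of v v] that by simp
    then have "d10 v x = d10 0 x" using that linear_pd[OF assms] by (simp add: d10_def linear_0)
    then show ?thesis by (rule injD[OF inj])
  qed
  then show ?thesis using linear_injective_0[OF linear_pd[OF assms]] by blast
qed

lemma eq_by_metric:
  assumes "x \<in> U" "\<And>z. pd F x p \<bullet> pd F x z = pd F x q \<bullet> pd F x z"
  shows "p = q"
proof -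
  have "(pd F x p - pd F x q) \<bullet> (pd F x p - pd F x q) = 0"
    using assms(2)[of "p - q"]
    unfolding linear_diff[OF linear_pd[OF assms(1)]] inner_diff_left[of "pd F x p"] by simp
  then have "pd F x p = pd F x q" by simp
  then show ?thesis by (rule injD[OF inj_pd[OF assms(1)]])
qed

lemma d10_differentiable: "x \<in> U \<Longrightarrow> d10 v differentiable (at x)"
  and pd_d10: "x \<in> U \<Longrightarrow> pd (d10 v) x u = to_complex_vec (DD u v x, - DD u (J v) x)"
proof -
  assume x: "x \<in> U"
  have "((\<lambda>y. (pd F y v, - pd F y (J v))) has_derivative (\<lambda>u. (DD u v x, - DD u (J v) x))) (at x)"
    by (intro has_derivative_Pair has_derivative_minus has_derivative_pd pd_differentiable x)
  then have "(d10 v has_derivative (\<lambda>u. to_complex_vec (DD u v x, - DD u (J v) x))) (at x)"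
    unfolding d10_def[abs_def] by (rule bounded_linear.has_derivative[OF bounded_linear_to_complex_vec])
  then show "d10 v differentiable (at x)" "pd (d10 v) x u = to_complex_vec (DD u v x, - DD u (J v) x)"
    by (auto simp: differentiable_def dest: pd_eqI)
qed

lemma pd_d10_differentiable: "x \<in> U \<Longrightarrow> (\<lambda>y. pd (d10 v) y w) differentiable (at x)"
  and pd_pd_d10: "x \<in> U \<Longrightarrow> pd (\<lambda>y. pd (d10 v) y w) x u
     = to_complex_vec (pd (DD w v) x u, - pd (DD w (J v)) x u)"
proof -
  assume x: "x \<in> U"
  have "((\<lambda>y. (DD w v y, - DD w (J v) y)) has_derivative (\<lambda>u. (pd (DD w v) x u, - pd (DD w (J v)) x u))) (at x)"
    by (intro has_derivative_Pair has_derivative_minus has_derivative_pd DD_differentiable x)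
  then have "((\<lambda>y. to_complex_vec (DD w v y, - DD w (J v) y)) has_derivative
     (\<lambda>u. to_complex_vec (pd (DD w v) x u, - pd (DD w (J v)) x u))) (at x)"
    by (rule bounded_linear.has_derivative[OF bounded_linear_to_complex_vec])
  then have "((\<lambda>y. pd (d10 v) y w) has_derivative
     (\<lambda>u. to_complex_vec (pd (DD w v) x u, - pd (DD w (J v)) x u))) (at x)"
    by (rule has_derivative_transform_within_open[OF _ openU x]) (simp add: pd_d10)
  then show "(\<lambda>y. pd (d10 v) y w) differentiable (at x)"
    "pd (\<lambda>y. pd (d10 v) y w) x u = to_complex_vec (pd (DD w v) x u, - pd (DD w (J v)) x u)"
    by (auto simp: differentiable_def dest: pd_eqI)
qed

lemma P_differentiable: "x \<in> U \<Longrightarrow> P differentiable (at x)"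
  by (rule smooth_on_differentiable[OF smooth_P])

lemma pd_P_differentiable: "x \<in> U \<Longrightarrow> (\<lambda>y. pd P y w) differentiable (at x)"
  by (rule smooth_on_differentiable[OF smooth_on_pd[OF smooth_P]])

lemma P_d10: "x \<in> U \<Longrightarrow> P x *v d10 v x = d10 v x"
  by (rule herm_proj_id[OF subspace_E proj d10_in])

lemma pd_P_d10:
  assumes "x \<in> U"
  shows "pd (d10 v) x u = P x *v pd (d10 v) x u + pd P x u *v d10 v x"
proof -
  have "pd (d10 v) x u = pd (\<lambda>y. P y *v d10 v y) x u"
    using pd_cong[OF openU assms, of "d10 v" "\<lambda>y. P y *v d10 v y"] P_d10 by simp
  also have "\<dots> = P x *v pd (d10 v) x u + pd P x u *v d10 v x"
    by (rule pd_bounded_bilinear[OF bounded_bilinear_matrix_vector P_differentiable[OF assms]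
          d10_differentiable[OF assms]])
  finally show ?thesis .
qed

lemma pd_pd_P_d10:
  assumes "x \<in> U"
  shows "pd (\<lambda>y. pd (d10 v) y w) x u = P x *v pd (\<lambda>y. pd (d10 v) y w) x u + pd P x u *v pd (d10 v) x w
    + pd P x w *v pd (d10 v) x u + pd (\<lambda>y. pd P y w) x u *v d10 v x"
proof -
  note B = bounded_bilinear_matrix_vector
  have 1: "(\<lambda>y. P y *v pd (d10 v) y w) differentiable (at x)"
    by (rule differentiable_bounded_bilinear[OF B P_differentiable[OF assms] pd_d10_differentiable[OF assms]])
  have 2: "(\<lambda>y. pd P y w *v d10 v y) differentiable (at x)"
    by (rule differentiable_bounded_bilinear[OF B pd_P_differentiable[OF assms] d10_differentiable[OF assms]])
  have "pd (\<lambda>y. pd (d10 v) y w) x u = pd (\<lambda>y. P y *v pd (d10 v) y w + pd P y w *v d10 v y) x u"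
    by (rule fun_cong[OF pd_cong[OF openU assms pd_P_d10]])
  also have "\<dots> = pd (\<lambda>y. P y *v pd (d10 v) y w) x u + pd (\<lambda>y. pd P y w *v d10 v y) x u"
    using pd_eqI[OF has_derivative_add[OF has_derivative_pd[OF 1] has_derivative_pd[OF 2]]] by simp
  also have "pd (\<lambda>y. P y *v pd (d10 v) y w) x u
      = P x *v pd (\<lambda>y. pd (d10 v) y w) x u + pd P x u *v pd (d10 v) x w"
    by (rule pd_bounded_bilinear[OF B P_differentiable[OF assms] pd_d10_differentiable[OF assms]])
  also have "pd (\<lambda>y. pd P y w *v d10 v y) x u
      = pd P x w *v pd (d10 v) x u + pd (\<lambda>y. pd P y w) x u *v d10 v x"
    by (rule pd_bounded_bilinear[OF B pd_P_differentiable[OF assms] d10_differentiable[OF assms]])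
  finally show ?thesis unfolding add.assoc .
qed

text \<open>In \<open>\<partial>\<^sub>u (d10 v) = P \<partial>\<^sub>u (d10 v) + (\<partial>\<^sub>u P) d10 v\<close> the first summand lies in \<open>E\<close> and the second, by
  horizontality, in \<open>N\<close>; both are annihilated by \<open>bil\<close> with \<open>E\<close>. The real part of this is the equation
  \<open>\<langle>\<nabla>\<^sub>u (J v), J w\<rangle> = \<langle>\<nabla>\<^sub>u v, w\<rangle>\<close> for the induced connection.\<close>

lemma horizontal_pd:
  assumes "x \<in> U"
  shows "DD u (J v) x \<bullet> pd F x (J w) = DD u v x \<bullet> pd F x w"
proof -
  have "P x *v pd (d10 v) x u \<in> E x" by (rule herm_proj_in[OF subspace_E[OF assms] proj[OF assms]])
  then have "bil (P x *v pd (d10 v) x u) (d10 w x) = 0"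
    using Z1[OF assms] d10_in[OF assms] by (simp add: Z1_def)
  moreover have "pd P x u *v d10 v x \<in> N_of (E x)"
    using horizontal[OF assms] d10_in[OF assms] by (simp add: horizontal_vector_def)
  then have "bil (pd P x u *v d10 v x) (d10 w x) = 0"
    using N_of_iff[OF subspace_E[OF assms]] d10_in[OF assms] by blast
  ultimately have "bil (pd (d10 v) x u) (d10 w x) = 0"
    by (subst pd_P_d10[OF assms]) simp
  then show ?thesis by (simp add: pd_d10[OF assms] d10_def bil_to_complex_vec complex_eq_iff)
qed

text \<open>Two applications of \<open>horizontal_pd\<close>, separated by a change of the order of differentiation, turn
  \<open>\<langle>F\<^sub>J\<^sub>v\<^sub>J\<^sub>w, dF z\<rangle>\<close> into \<open>-\<langle>F\<^sub>v\<^sub>w, dF z\<rangle>\<close>; the sign comes from \<open>z = -J (J z)\<close>.\<close>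

lemma mixed_normal:
  assumes "x \<in> U"
  shows "mixed v w x \<bullet> pd F x z = 0"
proof -
  have "DD (J v) (J w) x \<bullet> pd F x z = - (DD (J v) (J w) x \<bullet> pd F x (J (J z)))"
    by (simp add: pd_linear_simps[OF assms])
  also have "\<dots> = - (DD w (J v) x \<bullet> pd F x (J z))"
    by (simp only: horizontal_pd[OF assms, of w "J v" "J z"] DD_commute[OF assms, of w "J v"])
  also have "\<dots> = - (DD v w x \<bullet> pd F x z)"
    by (simp only: horizontal_pd[OF assms, of v w z] DD_commute[OF assms, of v w])
  finally show ?thesis by (simp add: mixed_def inner_add_left)
qed

abbreviation \<Gamma> :: "complex^'m \<Rightarrow> complex^'m \<Rightarrow> complex^'m \<Rightarrow> complex^'m"
  where "\<Gamma> u v x \<equiv> christoffel (pullback_metric F) x u v"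

text \<open>The Koszul formula for the induced metric reduces to \<open>\<langle>F\<^sub>u\<^sub>v, dF z\<rangle>\<close>, so \<open>dF(\<Gamma> u v)\<close> is the tangential
  part of \<open>F\<^sub>u\<^sub>v\<close>; the orthogonal projection provides the vector that the definite description asks for.\<close>

lemma christoffel_metric:
  assumes "x \<in> U"
  shows "pd F x (\<Gamma> u v x) \<bullet> pd F x z = DD u v x \<bullet> pd F x z"
proof -
  have d: "pd (\<lambda>y. pullback_metric F y p q) x r = pd F x p \<bullet> DD r q x + DD r p x \<bullet> pd F x q" for p q r
    unfolding pullback_metric_def by (rule pd_bounded_bilinear[OF bounded_bilinear_inner pd_differentiable[OF assms] pd_differentiable[OF assms]])
  have K: "(pd (\<lambda>y. pullback_metric F y v z) x u + pd (\<lambda>y. pullback_metric F y u z) x v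
      - pd (\<lambda>y. pullback_metric F y u v) x z) / 2 = DD u v x \<bullet> pd F x z" for z
    unfolding d using DD_commute[OF assms, of u v] DD_commute[OF assms, of z u] DD_commute[OF assms, of z v]
    by (simp add: inner_commute)
  have sp: "span (range (pd F x)) = range (pd F x)"
    using linear_subspace_image[OF linear_pd[OF assms] subspace_UNIV] by simp
  obtain y where y: "orth_proj (range (pd F x)) (DD u v x) = pd F x y"
    using orth_proj_exists(1)[of "range (pd F x)" "DD u v x"] unfolding sp by blast
  have ex: "pd F x y \<bullet> pd F x z = DD u v x \<bullet> pd F x z" for z
    using orth_proj_exists(2)[of "pd F x z" "range (pd F x)" "DD u v x"] by (simp add: y inner_diff_left)
  have "\<Gamma> u v x = y"
    unfolding christoffel_def K
  proof (rule the_equality)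
    show "\<forall>z. pullback_metric F x y z = DD u v x \<bullet> pd F x z" using ex by (simp add: pullback_metric_def)
    show "y' = y" if "\<forall>z. pullback_metric F x y' z = DD u v x \<bullet> pd F x z" for y'
      using that ex by (intro eq_by_metric[OF assms]) (simp add: pullback_metric_def)
  qed
  then show ?thesis using ex by simp
qed

lemma christoffel_commute:
  assumes "x \<in> U"
  shows "\<Gamma> u v x = \<Gamma> v u x"
  by (rule eq_by_metric[OF assms]) (simp only: christoffel_metric[OF assms] DD_commute[OF assms, of v u])

lemma christoffel_J:
  assumes "x \<in> U"
  shows "\<Gamma> u (J v) x = J (\<Gamma> u v x)"
proof (rule eq_by_metric[OF assms])
  fix z :: "complex^'m"
  have z: "z = J (- J z)" by simp
  show "pd F x (\<Gamma> u (J v) x) \<bullet> pd F x z = pd F x (J (\<Gamma> u v x)) \<bullet> pd F x z"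
    by (subst z, subst (2) z)
      (simp only: christoffel_metric[OF assms] horizontal_pd[OF assms] isotropic[OF assms])
qed

text \<open>As \<open>J\<close> is parallel, the tangential part of \<open>\<partial>\<^sub>u (d10 v)\<close> is \<open>d10 (\<Gamma> u v)\<close>.\<close>

lemma tangential_pd_d10:
  assumes "x \<in> U"
  shows "pd (d10 v) x u - d10 (\<Gamma> u v x) x \<in> herm_perp (E x)"
proof -
  have "herm (pd (d10 v) x u - d10 (\<Gamma> u v x) x) (d10 w x) = 0" for w
    by (simp only: herm_right herm_left) (simp add: pd_d10[OF assms] d10_def herm_to_complex_vec complex_eq_iff
      christoffel_metric[OF assms] christoffel_J[OF assms, symmetric])
  then show ?thesis by (auto simp: E_eq[OF assms] herm_perp_def)
qed

text \<open>The derivative of a field of projections interchanges the image and its complement; this is one half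
  of that, obtained from \<open>P P = P\<close>.\<close>

lemma pd_P_perp:
  assumes "x \<in> U" "r \<in> herm_perp (E x)"
  shows "pd P x u *v r \<in> E x"
proof -
  note B = bounded_bilinear_matrix_vector and D = P_differentiable[OF assms(1)]
  have L: "bounded_linear (\<lambda>M :: complex^'n^'n. M *v r)" by (rule bounded_bilinear.bounded_linear_left[OF B])
  have "P y *v (P y *v r) = P y *v r" if "y \<in> U" for y
    by (rule herm_proj_id[OF subspace_E[OF that] proj[OF that] herm_proj_in[OF subspace_E[OF that] proj[OF that]]])
  then have "pd (\<lambda>y. P y *v r) x u = pd (\<lambda>y. P y *v (P y *v r)) x u"
    using pd_cong[OF openU assms(1), of "\<lambda>y. P y *v r" "\<lambda>y. P y *v (P y *v r)"] by simp
  also have "\<dots> = P x *v pd (\<lambda>y. P y *v r) x u + pd P x u *v (P x *v r)"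
    by (rule pd_bounded_bilinear[OF B D differentiable_bounded_linear[OF L D]])
  also have "P x *v r = 0" by (rule herm_proj_0[OF subspace_E[OF assms(1)] proj[OF assms(1)] assms(2)])
  finally have "pd P x u *v r = P x *v (pd P x u *v r)"
    by (simp add: pd_bounded_linear[OF L D])
  then show ?thesis using herm_proj_in[OF subspace_E[OF assms(1)] proj[OF assms(1)]] by metis
qed

lemma normal_in_N:
  assumes "x \<in> U" "\<And>z. pd F x z \<bullet> \<nu> = 0"
  shows "complex_vec \<nu> \<in> N_of (E x)"
  unfolding N_of_iff[OF subspace_E[OF assms(1)]]
  using assms(2) by (auto simp: E_eq[OF assms(1)] complex_vec_eq d10_def herm_to_complex_vec bil_to_complex_vec complex_eq_iff inner_commute)

lemma pd_pd_P_self_adjoint: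
  assumes "x \<in> U"
  shows "herm (pd (\<lambda>y. pd P y w) x v *v p) q = herm p (pd (\<lambda>y. pd P y w) x v *v q)"
proof -
  define L where "L M = herm (M *v p) q - herm p (M *v q)" for M :: "complex^'n^'n"
  have "linear L"
    by (simp add: linear_iff L_def matrix_vector_mult_add_rdistrib scaleR_matrix_vector_assoc[symmetric]
        scaleR_complex_vec bounded_bilinear.scaleR_left[OF bounded_bilinear_matrix_vector] algebra_simps)
      (simp add: scaleR_conv_of_real algebra_simps)
  then have L: "bounded_linear L" by (simp add: linear_conv_bounded_linear)
  have 0: "L (P y) = 0" if "y \<in> U" for y
    using herm_proj_self_adjoint[OF subspace_E[OF that] proj[OF that]] by (simp add: L_def)
  have 1: "L (pd P y w) = 0" if "y \<in> U" for y
    by (rule pd_in_kernel[OF openU that L P_differentiable[OF that] 0])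
  have "L (pd (\<lambda>y. pd P y w) x v) = 0"
    by (rule pd_in_kernel[OF openU assms L pd_P_differentiable[OF assms] 1])
  then show ?thesis by (simp add: L_def)
qed

text \<open>Differentiate \<open>P d10 z = d10 z\<close> along \<open>w\<close> and \<open>v\<close> and pair with the normal vector \<open>\<nu>\<close>, which kills the
  image of \<open>P\<close>. In the terms \<open>(\<partial>\<^sub>v P) \<partial>\<^sub>w (d10 z)\<close> only the component \<open>d10 (\<Gamma> w z)\<close> in \<open>E\<close> counts, as
  \<open>\<partial>\<^sub>v P\<close> maps the complement of \<open>E\<close> into \<open>E\<close>; and on \<open>E\<close> the operator \<open>\<partial>\<^sub>v P\<close> gives the normal part of
  \<open>\<partial>\<^sub>v\<close>.\<close>

lemma third_derivative_normal:
  assumes x: "x \<in> U" and \<nu>: "\<And>z. pd F x z \<bullet> \<nu> = 0"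
  shows "pd (DD w z) x v \<bullet> \<nu> = DD v (\<Gamma> w z x) x \<bullet> \<nu> + DD w (\<Gamma> v z x) x \<bullet> \<nu>
    + Re (herm (pd (\<lambda>y. pd P y w) x v *v d10 z x) (complex_vec \<nu>))"
proof -
  let ?Y = "complex_vec \<nu>"
  have Y: "?Y \<in> N_of (E x)" by (rule normal_in_N[OF x \<nu>])
  have EY: "herm e ?Y = 0" if "e \<in> E x" for e
    using Y that N_of_iff[OF subspace_E[OF x]] herm_commute[of e ?Y] by auto
  have PY: "herm (P x *v e) ?Y = 0" for e
    by (rule EY[OF herm_proj_in[OF subspace_E[OF x] proj[OF x]]])
  have step: "herm (pd P x v *v pd (d10 z) x w) ?Y = herm (pd (d10 (\<Gamma> w z x)) x v) ?Y" for v w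
  proof -
    let ?q = "\<Gamma> w z x"
    have "pd P x v *v pd (d10 z) x w = pd P x v *v d10 ?q x + pd P x v *v (pd (d10 z) x w - d10 ?q x)"
      by (simp flip: vec.add)
    moreover have "herm (pd P x v *v (pd (d10 z) x w - d10 ?q x)) ?Y = 0"
      by (rule EY[OF pd_P_perp[OF x tangential_pd_d10[OF x]]])
    moreover have "herm (pd P x v *v d10 ?q x) ?Y = herm (pd (d10 ?q) x v) ?Y"
      using arg_cong[OF pd_P_d10[OF x, of ?q v], of "\<lambda>e. herm e ?Y"] by (simp add: PY)
    ultimately show ?thesis by simp
  qed
  have "herm (pd (\<lambda>y. pd (d10 z) y w) x v) ?Y =
     herm (pd (d10 (\<Gamma> w z x)) x v) ?Y + herm (pd (d10 (\<Gamma> v z x)) x w) ?Y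
     + herm (pd (\<lambda>y. pd P y w) x v *v d10 z x) ?Y"
    using arg_cong[OF pd_pd_P_d10[OF x, of z w v], of "\<lambda>e. herm e ?Y"] by (simp add: PY step)
  from arg_cong[OF this, of Re] show ?thesis
    by (simp add: pd_pd_d10[OF x] pd_d10[OF x] complex_vec_eq herm_to_complex_vec)
qed

lemma third_derivative_commute:
  assumes "x \<in> U"
  shows "pd (DD w z) x v = pd (DD v w) x z"
proof -
  have "pd (DD w z) x v = pd (DD z w) x v"
    using pd_cong[OF openU assms, of "DD w z" "DD z w"] DD_commute by simp
  also have "\<dots> = pd (DD v w) x z" by (rule pd_commute[OF openU assms smooth_on_pd[OF smooth_F]])
  finally show ?thesis .
qed

lemma mixed_differentiable: "x \<in> U \<Longrightarrow> mixed v w differentiable (at x)"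
  unfolding mixed_def[abs_def] by (intro differentiable_add DD_differentiable)

lemma pd_mixed:
  assumes "x \<in> U"
  shows "pd (mixed v w) x z = pd (DD v w) x z + pd (DD (J v) (J w)) x z"
  unfolding mixed_def[abs_def]
  using pd_eqI[OF has_derivative_add[OF has_derivative_pd[OF DD_differentiable[OF assms]] has_derivative_pd[OF DD_differentiable[OF assms]]]]
  by simp

lemma mixed_commute: "x \<in> U \<Longrightarrow> mixed v w x = mixed w v x"
  by (simp add: mixed_def DD_commute[of x v w] DD_commute[of x "J v" "J w"])

text \<open>Adding the formula for \<open>(v, w)\<close> and for \<open>(J v, J w)\<close> makes the terms with second derivatives of \<open>P\<close>
  cancel, by the hypothesis \<open>ph\<close>, the form that pluriharmonicity takes in a chart. As \<open>\<Gamma> (J v) z = J (\<Gamma> v z)\<close>,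
  the other terms combine to values of \<open>mixed\<close>.\<close>

lemma pd_mixed_normal:
  assumes x: "x \<in> U" and \<nu>: "\<And>z. pd F x z \<bullet> \<nu> = 0"
    and ph: "\<And>t. t \<in> tangent_space (proj_mat ` Z1 CARD('m)) (P x) \<Longrightarrow>
      (pd (\<lambda>y. pd P y w) x v + pd (\<lambda>y. pd P y (J w)) x (J v)) \<bullet> t = 0"
  shows "pd (mixed v w) x z \<bullet> \<nu> = mixed (\<Gamma> z v x) w x \<bullet> \<nu> + mixed v (\<Gamma> z w x) x \<bullet> \<nu>"
proof -
  let ?H = "pd (\<lambda>y. pd P y w) x v + pd (\<lambda>y. pd P y (J w)) x (J v)"
  have adj: "herm (?H *v p) q = herm p (?H *v q)" for p q
    by (simp add: matrix_vector_mult_add_rdistrib pd_pd_P_self_adjoint[OF x])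
  have "herm (?H *v d10 z x) (complex_vec \<nu>) = 0"
    using ph unfolding proj_mat_eq[OF subspace_E[OF x] proj[OF x], symmetric]
    by (intro normal_to_horizontal[OF Z1[OF x] adj _ d10_in[OF x] normal_in_N[OF x \<nu>]])
  then have H: "Re (herm (pd (\<lambda>y. pd P y w) x v *v d10 z x) (complex_vec \<nu>))
     + Re (herm (pd (\<lambda>y. pd P y (J w)) x (J v) *v d10 z x) (complex_vec \<nu>)) = 0"
    by (simp add: matrix_vector_mult_add_rdistrib complex_eq_iff)
  have "pd (mixed v w) x z = pd (DD w z) x v + pd (DD (J w) z) x (J v)"
    using third_derivative_commute[OF x] by (simp add: pd_mixed[OF x])
  then have "pd (mixed v w) x z \<bullet> \<nu> = DD v (\<Gamma> z w x) x \<bullet> \<nu> + DD w (\<Gamma> z v x) x \<bullet> \<nu>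
     + DD (J v) (J (\<Gamma> z w x)) x \<bullet> \<nu> + DD (J w) (J (\<Gamma> z v x)) x \<bullet> \<nu>"
    using third_derivative_normal[OF x \<nu>] H by (simp add: inner_add_left christoffel_commute[OF x, of _ z] christoffel_J[OF x])
  then show ?thesis
    by (simp add: mixed_commute[OF x, of "\<Gamma> z v x"]) (simp add: mixed_def inner_add_left)
qed

lemma second_ff11_eq_mixed:
  assumes "x \<in> U"
  shows "(1/2) *\<^sub>R (normal_part (range (pd F x)) (DD v w x) + normal_part (range (pd F x)) (DD (J v) (J w) x))
    = (1/2) *\<^sub>R mixed v w x"
proof -
  have "normal_part (range (pd F x)) (mixed v w x) = mixed v w x"
    using mixed_normal[OF assms] by (intro normal_part_id) auto
  then show ?thesis by (simp add: normal_part_add mixed_def)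
qed

text \<open>The difference of the two sides is normal, and \<open>pd_mixed_normal\<close> shows that it is orthogonal to all
  normal vectors, in particular to itself.\<close>

lemma parallel_mixed:
  assumes x: "x \<in> U"
    and ph: "\<And>t v w. t \<in> tangent_space (proj_mat ` Z1 CARD('m)) (P x) \<Longrightarrow>
      (pd (\<lambda>y. pd P y w) x v + pd (\<lambda>y. pd P y (J w)) x (J v)) \<bullet> t = 0"
  shows "normal_part (range (pd F x)) (pd (mixed v w) x u) = mixed (\<Gamma> u v x) w x + mixed v (\<Gamma> u w x) x"
proof -
  let ?R = "range (pd F x)"
  let ?d = "normal_part ?R (pd (mixed v w) x u) - (mixed (\<Gamma> u v x) w x + mixed v (\<Gamma> u w x) x)"
  have d: "pd F x z \<bullet> ?d = 0" for z
    using normal_part_orthogonal[of "pd F x z" ?R "pd (mixed v w) x u"] mixed_normal[OF x]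
    by (simp add: inner_commute[of "pd F x z"] inner_diff_left inner_add_left)
  have "normal_part ?R (pd (mixed v w) x u) \<bullet> ?d = pd (mixed v w) x u \<bullet> ?d"
    by (rule normal_part_inner) (use d in \<open>auto simp: inner_commute\<close>)
  also have "\<dots> = (mixed (\<Gamma> u v x) w x + mixed v (\<Gamma> u w x) x) \<bullet> ?d"
    unfolding inner_add_left by (rule pd_mixed_normal[OF x d ph])
  finally have "?d \<bullet> ?d = 0" by (simp only: inner_diff_left)
  then show ?thesis by simp
qed

lemma section_perp:
  assumes "x \<in> U" "complex_vec (F x) \<in> N_of (E x)"
  shows "F x \<bullet> pd F x v = 0"
proof -
  have "herm (complex_vec (F x)) (d10 v x) = 0"
    using assms N_of_iff[OF subspace_E[OF assms(1)]] d10_in by blast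
  then show ?thesis by (simp add: complex_vec_eq d10_def herm_to_complex_vec complex_eq_iff)
qed

lemma norm_locally_constant:
  assumes "x \<in> U" and N: "\<And>y. y \<in> U \<Longrightarrow> complex_vec (F y) \<in> N_of (E y)"
  obtains V where "open V" "x \<in> V" "V \<subseteq> U" "\<And>y. y \<in> V \<Longrightarrow> norm (F y) = norm (F x)"
proof -
  obtain r where r: "r > 0" "ball x r \<subseteq> U" using openU assms(1) openE by blast
  have D: "((\<lambda>y. F y \<bullet> F y) has_derivative (\<lambda>v. 0)) (at y)" if "y \<in> U" for y
    using has_derivative_inner[OF has_derivative_pd has_derivative_pd, of F y F]
      smooth_on_differentiable[OF smooth_F that] section_perp[OF that N[OF that]]
    by (simp add: inner_commute)
  have "((\<lambda>y. F y \<bullet> F y) has_derivative (\<lambda>v. 0)) (at y within ball x r)" if "y \<in> ball x r" for y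
    by (rule has_derivative_at_withinI[OF D[OF subsetD[OF r(2) that]]])
  from has_derivative_zero_constant[OF convex_ball this]
  obtain k where k: "F y \<bullet> F y = k" if "y \<in> ball x r" for y by blast
  have x: "x \<in> ball x r" using r(1) by simp
  have "norm (F y) = norm (F x)" if "y \<in> ball x r" for y
    unfolding norm_eq k[OF that] k[OF x] ..
  then show ?thesis by (rule that[OF open_ball x r(2)])
qed

text \<open>A zero of \<open>F\<close> would propagate to a neighbourhood, where \<open>dF\<close> would vanish too. Any nonzero vector,
  such as a vector of the standard basis, then contradicts injectivity.\<close>

lemma section_nonzero:
  assumes "x \<in> U" and N: "\<And>y. y \<in> U \<Longrightarrow> complex_vec (F y) \<in> N_of (E y)"
  shows "F x \<noteq> 0"
proof
  assume 0: "F x = 0"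
  obtain V where V: "open V" "x \<in> V" "V \<subseteq> U" "\<And>y. y \<in> V \<Longrightarrow> norm (F y) = norm (F x)"
    using norm_locally_constant[OF assms] by blast
  have "pd F x = pd (\<lambda>y. 0) x"
    using V(4) 0 by (intro pd_cong[OF V(1,2)]) simp
  then have "pd F x (axis undefined 1) = pd F x 0" by simp
  then have "axis undefined 1 = (0 :: complex^'m)" by (rule injD[OF inj_pd[OF assms(1)]])
  then show False by simp
qed

end

lemma smooth_map_normalize:
  assumes "open U" "smooth_on U F"
    and loc: "\<And>x. x \<in> U \<Longrightarrow> \<exists>V. open V \<and> x \<in> V \<and> (\<forall>y\<in>V. norm (F y) = norm (F x))"
  shows "smooth_on U (\<lambda>x. (1 / norm (F x)) *\<^sub>R F x)"
    and "x \<in> U \<Longrightarrow> pd (\<lambda>x. (1 / norm (F x)) *\<^sub>R F x) x v = (1 / norm (F x)) *\<^sub>R pd F x v"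
proof -
  show "smooth_on U (\<lambda>x. (1 / norm (F x)) *\<^sub>R F x)"
    unfolding smooth_on_def
  proof
    fix k
    have "\<exists>V. open V \<and> x \<in> V \<and> (\<forall>y\<in>V. (*\<^sub>R) (1 / norm (F y)) = ((*\<^sub>R) (1 / norm (F x)) :: 'b \<Rightarrow> 'b))"
      if x: "x \<in> U" for x
    proof -
      obtain V where V: "open V" "x \<in> V" "\<forall>y\<in>V. norm (F y) = norm (F x)" using loc[OF x] by blast
      have "(*\<^sub>R) (1 / norm (F y)) = ((*\<^sub>R) (1 / norm (F x)) :: 'b \<Rightarrow> 'b)" if "y \<in> V" for y
        unfolding bspec[OF V(3) that] ..
      then show ?thesis using V(1,2) by blast
    qed
    moreover have "k_smooth_on k U F" using assms(2) by (simp add: smooth_on_def)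
    ultimately show "k_smooth_on k U (\<lambda>x. (1 / norm (F x)) *\<^sub>R F x)"
      by (rule k_smooth_on_locally_constant_linear[where L = "\<lambda>x. (*\<^sub>R) (1 / norm (F x))",
            OF assms(1) bounded_linear_scaleR_right])
  qed
  assume x: "x \<in> U"
  obtain V where V: "open V" "x \<in> V" "\<And>y. y \<in> V \<Longrightarrow> norm (F y) = norm (F x)" using loc[OF x] by blast
  have "pd (\<lambda>x. (1 / norm (F x)) *\<^sub>R F x) x v = pd (\<lambda>y. (1 / norm (F x)) *\<^sub>R F y) x v"
    by (rule fun_cong[OF pd_cong[OF V(1,2)]]) (simp add: V(3))
  also have "\<dots> = (1 / norm (F x)) *\<^sub>R pd F x v"
    by (rule pd_bounded_linear[OF bounded_linear_scaleR_right[of "1 / norm (F x)"] smooth_on_differentiable[OF assms(2) x]])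
  finally show "pd (\<lambda>x. (1 / norm (F x)) *\<^sub>R F x) x v = (1 / norm (F x)) *\<^sub>R pd F x v" .
qed

section \<open>Pluriharmonicity\<close>

lemma metric_christoffel_commute:
  assumes "open U" "x \<in> U" and sym: "\<And>y v w. y \<in> U \<Longrightarrow> h y v w = h y w v"
  shows "christoffel h x v w = christoffel h x w v"
proof -
  have "pd (\<lambda>y. h y v w) x = pd (\<lambda>y. h y w v) x" by (rule pd_cong[OF assms(1,2) sym])
  then show ?thesis unfolding christoffel_def by (simp add: add.commute)
qed

text \<open>Take \<open>X = v - i J v\<close> and \<open>Y = w + i J w\<close>. The Christoffel terms of the real part of the Hessian
  cancel, because \<open>\<Gamma>\<close> is symmetric and commutes with \<open>J\<close> in either argument, so that
  \<open>\<Gamma> (-J v) (J w) = \<Gamma> v w\<close>.\<close>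

lemma pluriharmonic_chart:
  assumes M: "kaehler_manifold A g" and ph: "pluriharmonic A g S \<phi>"
    and c: "c \<in> A" and x: "x \<in> chart_ran c" and t: "t \<in> tangent_space S ((\<phi> \<circ> param c) x)"
  shows "(pd (\<lambda>y. pd (\<phi> \<circ> param c) y w) x v + pd (\<lambda>y. pd (\<phi> \<circ> param c) y (J w)) x (J v)) \<bullet> t = 0"
proof -
  let ?\<Phi> = "\<phi> \<circ> param c" and ?G = "christoffel (g c) x"
  let ?\<pi> = "orth_proj (tangent_space S (?\<Phi> x))"
  have U: "open (chart_ran c)" using M c by (auto simp: kaehler_manifold_def complex_atlas_def)
  have comm: "?G p q = ?G q p" for p q
    using M c by (intro metric_christoffel_commute[OF U x]) (auto simp: kaehler_manifold_def riemannian_metric_def)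
  have GJ: "?G p (J q) = J (?G p q)" for p q
    using M c x by (auto simp: kaehler_manifold_def kaehler_condition_def)
  have "?G (- J v) (J w) = ?G (J w) (J (J (J v)))" using comm by simp
  also have "\<dots> = - J (?G (J w) v)" unfolding GJ by simp
  also have "\<dots> = - J (?G v (J w))" using comm by simp
  also have "\<dots> = ?G v w" unfolding GJ by simp
  finally have G: "?G (- J v) (J w) = ?G v w" .
  have sm: "smooth_on (chart_ran c) ?\<Phi>" using ph c by (auto simp: pluriharmonic_def smooth_map_def)
  have lin: "linear (pd (\<lambda>y. pd ?\<Phi> y (J w)) x)"
    by (rule pd_linear[OF smooth_on_differentiable[OF smooth_on_pd[OF sm] x]])
  have "(v, - J v) \<in> T10" "(w, J w) \<in> T01"
    by (auto simp: T10_def T01_def lin_ext_def mult_i_def)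
  then have "bil_ext (hessian g S \<phi> c x) (v, - J v) (w, J w) = 0"
    using ph c x by (auto simp: pluriharmonic_def)
  then have "hessian g S \<phi> c x v w = hessian g S \<phi> c x (- J v) (J w)"
    by (simp add: bil_ext_def zero_prod_def)
  then have "?\<pi> (pd (\<lambda>y. pd ?\<Phi> y w) x v) = ?\<pi> (- pd (\<lambda>y. pd ?\<Phi> y (J w)) x (J v))"
    by (simp add: hessian_def Let_def G linear_neg[OF lin])
  then have "?\<pi> (pd (\<lambda>y. pd ?\<Phi> y w) x v + pd (\<lambda>y. pd ?\<Phi> y (J w)) x (J v))
      = ?\<pi> (- pd (\<lambda>y. pd ?\<Phi> y (J w)) x (J v) + pd (\<lambda>y. pd ?\<Phi> y (J w)) x (J v))"
    by (simp only: orth_proj_add)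
  also have "\<dots> = 0" using orth_proj_eqI[of 0 _ 0] by (simp add: span_zero)
  finally show ?thesis using orth_proj_exists(2)[OF t, of "pd (\<lambda>y. pd ?\<Phi> y w) x v + pd (\<lambda>y. pd ?\<Phi> y (J w)) x (J v)"]
    by simp
qed

section \<open>The complex Gauss map\<close>

lemma complex_atlas_point:
  assumes "complex_atlas A"
  obtains c x where "c \<in> A" "x \<in> chart_ran c" "param c x = p"
proof -
  obtain c where c: "c \<in> A" "p \<in> chart_dom c"
    using assms unfolding complex_atlas_def by blast
  then have "homeomorphism (chart_dom c) (chart_ran c) (coord c) (param c)"
    using assms unfolding complex_atlas_def by blast
  then have "param c (coord c p) = p" using c(2) by (simp add: homeomorphism_def)
  then show ?thesis using that[of c "coord c p"] c by (simp add: chart_ran_def)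
qed

lemma isotropic_chart_param:
  assumes "kaehler_manifold A g" "\<forall>p. \<tau> p \<in> Z1 CARD('m)" "horizontal_Z1 A \<tau>" "pluriharmonic_Z1 A g \<tau>"
    and "smooth_map A f" "image_T10_eq A f \<tau>" "(c :: ('a::{t2_space, second_countable_topology}, 'm::finite) chart) \<in> A"
  shows "isotropic_chart (chart_ran c) (f \<circ> param c) (\<tau> \<circ> param c) ((\<lambda>p. proj_mat (\<tau> p)) \<circ> param c)"
proof
  show "open (chart_ran c)" using assms by (auto simp: kaehler_manifold_def complex_atlas_def)
  show "smooth_on (chart_ran c) (f \<circ> param c)"
    "smooth_on (chart_ran c) ((\<lambda>p. proj_mat (\<tau> p)) \<circ> param c)"
    using assms by (auto simp: smooth_map_def pluriharmonic_Z1_def pluriharmonic_def)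
  fix x v assume x: "x \<in> chart_ran c"
  show Z: "(\<tau> \<circ> param c) x \<in> Z1 CARD('m)" using assms by simp
  then show "is_herm_proj ((\<tau> \<circ> param c) x) (((\<lambda>p. proj_mat (\<tau> p)) \<circ> param c) x)"
    by (simp add: is_herm_proj_proj_mat Z1_def)
  show "(to_complex_vec \<circ> lin_ext (pd (f \<circ> param c) x)) ` T10 = (\<tau> \<circ> param c) x"
    using assms x by (simp add: image_T10_eq_def)
  show "horizontal_vector ((\<tau> \<circ> param c) x) (pd ((\<lambda>p. proj_mat (\<tau> p)) \<circ> param c) x v)"
    using assms x by (simp add: horizontal_Z1_def)
qed

lemma gauss_map_immersion:
  fixes A :: "('a::{t2_space, second_countable_topology}, 'm::finite) chart set"
    and f :: "'a \<Rightarrow> real^'n::finite"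
  assumes M: "kaehler_manifold A g" "\<forall>p. \<tau> p \<in> Z1 CARD('m)" "horizontal_Z1 A \<tau>"
    and ph: "pluriharmonic_Z1 A g \<tau>" and f: "smooth_map A f" "image_T10_eq A f \<tau>"
  shows "kaehler_immersion A f" "parallel_pluri_mean_curvature A f"
proof -
  have im: "induced_metric f c = pullback_metric (f \<circ> param c)" for c :: "('a, 'm) chart"
    by (simp add: fun_eq_iff induced_metric_def pullback_metric_def)
  show "kaehler_immersion A f"
    unfolding kaehler_immersion_def kaehler_condition_def im
  proof (intro conjI ballI allI f)
    fix c x v w assume c: "c \<in> A" and x: "x \<in> chart_ran c"
    interpret isotropic_chart "chart_ran c" "f \<circ> param c" "\<tau> \<circ> param c" "(\<lambda>p. proj_mat (\<tau> p)) \<circ> param c"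
      by (rule isotropic_chart_param[OF M ph f c])
    show "inj (pd (f \<circ> param c) x)" by (rule inj_pd[OF x])
    show "pullback_metric (f \<circ> param c) x (J v) (J w) = pullback_metric (f \<circ> param c) x v w"
      unfolding pullback_metric_def by (rule isotropic[OF x])
    show "christoffel (pullback_metric (f \<circ> param c)) x v (J w) = J (christoffel (pullback_metric (f \<circ> param c)) x v w)"
      by (rule christoffel_J[OF x])
  qed
  show "parallel_pluri_mean_curvature A f"
    unfolding parallel_pluri_mean_curvature_def im
  proof (intro ballI allI)
    fix c x u v w assume c: "c \<in> A" and x: "x \<in> chart_ran c"
    interpret isotropic_chart "chart_ran c" "f \<circ> param c" "\<tau> \<circ> param c" "(\<lambda>p. proj_mat (\<tau> p)) \<circ> param c"
      by (rule isotropic_chart_param[OF M ph f c])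
    have ff: "second_ff11 f c y v w = (1/2) *\<^sub>R mixed v w y" if "y \<in> chart_ran c" for y v w
      using second_ff11_eq_mixed[OF that] by (simp only: second_ff11_def second_ff_def normal_proj_def)
    have "pd (\<lambda>y. second_ff11 f c y v w) x u = pd (\<lambda>y. (1/2) *\<^sub>R mixed v w y) x u"
      by (rule fun_cong[OF pd_cong[OF openU x ff]])
    also have "\<dots> = (1/2) *\<^sub>R pd (mixed v w) x u"
      by (rule pd_bounded_linear[OF bounded_linear_scaleR_right[of "1/2"] mixed_differentiable[OF x]])
    also have "normal_proj f c x \<dots> = (1/2) *\<^sub>R normal_part (range (pd (f \<circ> param c) x)) (pd (mixed v w) x u)"
      by (simp add: normal_proj_def normal_part_scaleR)
    also have "\<dots> = (1/2) *\<^sub>R mixed (\<Gamma> u v x) w x + (1/2) *\<^sub>R mixed v (\<Gamma> u w x) x"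
      by (subst parallel_mixed[OF x])
        (use pluriharmonic_chart[OF M(1) ph[unfolded pluriharmonic_Z1_def] c x] in \<open>simp_all add: scaleR_add_right\<close>)
    finally show "normal_proj f c x (pd (\<lambda>y. second_ff11 f c y v w) x u)
       - second_ff11 f c x (\<Gamma> u v x) w - second_ff11 f c x v (\<Gamma> u w x) = 0"
      by (simp add: ff[OF x])
  qed
qed

lemma sphere_imp_section:
  fixes A :: "('a::{t2_space, second_countable_topology}, 'm::finite) chart set"
    and f :: "'a \<Rightarrow> real^'n::finite"
  assumes M: "kaehler_manifold A g" "\<forall>p. \<tau> p \<in> Z1 CARD('m)" "horizontal_Z1 A \<tau>"
    and ph: "pluriharmonic_Z1 A g \<tau>" and f: "smooth_map A f" "image_T10_eq A f \<tau>"
    and sph: "\<forall>p. f p \<in> sphere 0 1"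
  shows "real_section_N A \<tau> f"
  unfolding real_section_N_def
proof (intro conjI allI f)
  fix p
  obtain c x where c: "c \<in> A" and x: "x \<in> chart_ran c" and p: "param c x = p"
    using M(1) unfolding kaehler_manifold_def by (blast elim: complex_atlas_point)
  interpret isotropic_chart "chart_ran c" "f \<circ> param c" "\<tau> \<circ> param c" "(\<lambda>p. proj_mat (\<tau> p)) \<circ> param c"
    by (rule isotropic_chart_param[OF M ph f c])
  have d: "f \<circ> param c differentiable (at x)" by (rule smooth_on_differentiable[OF smooth_F x])
  have "pd (f \<circ> param c) x v \<bullet> (f \<circ> param c) x = 0" for v
  proof -
    have "pd (\<lambda>y. (f \<circ> param c) y \<bullet> (f \<circ> param c) y) x v = 0"
      using sph by (simp add: dot_square_norm)
    then show ?thesis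
      using pd_bounded_bilinear[OF bounded_bilinear_inner d d, of v] by (simp add: inner_commute)
  qed
  then show "complex_vec (f p) \<in> N_of (\<tau> p)"
    using normal_in_N[OF x, of "(f \<circ> param c) x"] by (simp add: p)
qed

text \<open>\<open>M\<close> may be disconnected, so \<open>f\<close> is divided by its length, which is locally constant, and not by a
  constant. Multiplying \<open>df\<close> at a point by a nonzero real factor preserves the complex subspace \<open>df(T')\<close>.\<close>

lemma normalized_section:
  fixes A :: "('a::{t2_space, second_countable_topology}, 'm::finite) chart set"
    and f :: "'a \<Rightarrow> real^'n::finite"
  assumes M: "kaehler_manifold A g" "\<forall>p. \<tau> p \<in> Z1 CARD('m)" "horizontal_Z1 A \<tau>"
    and ph: "pluriharmonic_Z1 A g \<tau>" and f: "real_section_N A \<tau> f" "image_T10_eq A f \<tau>"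
  defines "h \<equiv> \<lambda>p. (1 / norm (f p)) *\<^sub>R f p"
  shows "smooth_map A h" "image_T10_eq A h \<tau>" "h p \<in> sphere 0 1"
proof -
  have sm: "smooth_map A f" and N: "\<And>p. complex_vec (f p) \<in> N_of (\<tau> p)"
    using f(1) by (auto simp: real_section_N_def)
  note chart = isotropic_chart_param[OF M ph sm f(2)]
  have h: "h \<circ> param c = (\<lambda>x. (1 / norm ((f \<circ> param c) x)) *\<^sub>R (f \<circ> param c) x)" for c :: "('a, 'm) chart"
    by (simp add: h_def fun_eq_iff)
  have nz: "(f \<circ> param c) x \<noteq> 0" if "c \<in> A" "x \<in> chart_ran c" for c x
    by (rule isotropic_chart.section_nonzero[OF chart[OF that(1)] that(2)]) (simp add: N)
  have loc: "\<exists>V. open V \<and> x \<in> V \<and> (\<forall>y\<in>V. norm ((f \<circ> param c) y) = norm ((f \<circ> param c) x))"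
    if "c \<in> A" "x \<in> chart_ran c" for c x
  proof -
    have "complex_vec ((f \<circ> param c) y) \<in> N_of ((\<tau> \<circ> param c) y)" for y by (simp add: N)
    then show ?thesis
      using isotropic_chart.norm_locally_constant[OF chart[OF that(1)] that(2)] by metis
  qed
  have smc: "smooth_on (chart_ran c) (f \<circ> param c)" "open (chart_ran c)" if "c \<in> A" for c
    using isotropic_chart.smooth_F[OF chart[OF that]] isotropic_chart.openU[OF chart[OF that]] .
  show "smooth_map A h"
    unfolding smooth_map_def h using smooth_map_normalize(1)[OF smc(2,1) loc] by blast
  show "image_T10_eq A h \<tau>"
    unfolding image_T10_eq_def
  proof (intro ballI)
    fix c x assume c: "c \<in> A" and x: "x \<in> chart_ran c"
    define \<rho> where "\<rho> = 1 / norm ((f \<circ> param c) x)"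
    have \<rho>: "\<rho> \<noteq> 0" using nz[OF c x] by (simp add: \<rho>_def)
    have lin: "linear (pd (f \<circ> param c) x)" by (rule isotropic_chart.linear_pd[OF chart[OF c] x])
    have "pd (h \<circ> param c) x v = \<rho> *\<^sub>R pd (f \<circ> param c) x v" for v
      unfolding h \<rho>_def by (rule smooth_map_normalize(2)[OF smc(2,1)[OF c] loc[OF c] x])
    then have *: "lin_ext (pd (h \<circ> param c) x) X = lin_ext (pd (f \<circ> param c) x) (\<rho> *\<^sub>R X)" for X
      using lin by (simp add: lin_ext_def linear_scale)
    have "(\<lambda>X. \<rho> *\<^sub>R X) ` T10 = (T10 :: ((complex^'m) \<times> (complex^'m)) set)"
    proof
      show "(\<lambda>X. \<rho> *\<^sub>R X) ` T10 \<subseteq> (T10 :: ((complex^'m) \<times> (complex^'m)) set)"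
        by (auto simp: T10_def lin_ext_def mult_i_def)
      show "T10 \<subseteq> (\<lambda>X. \<rho> *\<^sub>R X) ` (T10 :: ((complex^'m) \<times> (complex^'m)) set)"
      proof
        fix X :: "(complex^'m) \<times> (complex^'m)" assume "X \<in> T10"
        then have "(1 / \<rho>) *\<^sub>R X \<in> T10" by (auto simp: T10_def lin_ext_def mult_i_def)
        then show "X \<in> (\<lambda>X. \<rho> *\<^sub>R X) ` T10" using \<rho> by (intro image_eqI) auto
      qed
    qed
    then have "(to_complex_vec \<circ> lin_ext (pd (h \<circ> param c) x)) ` T10
        = (to_complex_vec \<circ> lin_ext (pd (f \<circ> param c) x)) ` T10"
      by (metis (no_types, lifting) * comp_apply image_cong image_image)
    also have "\<dots> = \<tau> (param c x)" using f(2) c x by (simp add: image_T10_eq_def)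
    finally show "(to_complex_vec \<circ> lin_ext (pd (h \<circ> param c) x)) ` T10 = \<tau> (param c x)" .
  qed
  obtain c x where "c \<in> A" "x \<in> chart_ran c" and p: "param c x = p"
    using M(1) unfolding kaehler_manifold_def by (blast elim: complex_atlas_point)
  then have "f p \<noteq> 0" using nz[of c x] by simp
  then show "h p \<in> sphere 0 1" by (simp add: h_def)
qed

theorem theorem6:
  fixes A :: "('a::{t2_space, second_countable_topology}, 'm::finite) chart set"
    and g :: "('a, 'm) metric"
    and \<tau> :: "'a \<Rightarrow> (complex^'n::finite) set"
  assumes "kaehler_manifold A g"
    and "\<forall>p. \<tau> p \<in> Z1 CARD('m)"
    and "horizontal_Z1 A \<tau>"
    and "pluriharmonic_Z1 A g \<tau>"
  shows "(\<exists>f :: 'a \<Rightarrow> real^'n.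
            kaehler_immersion A f \<and> (\<forall>p. f p \<in> sphere 0 1) \<and>
            parallel_pluri_mean_curvature A f \<and> is_complex_gauss_map A f \<tau>)
         \<longleftrightarrow>
         (\<exists>f :: 'a \<Rightarrow> real^'n. real_section_N A \<tau> f \<and> image_T10_eq A f \<tau>)"
proof
  assume "\<exists>f :: 'a \<Rightarrow> real^'n. kaehler_immersion A f \<and> (\<forall>p. f p \<in> sphere 0 1) \<and>
            parallel_pluri_mean_curvature A f \<and> is_complex_gauss_map A f \<tau>"
  then obtain f :: "'a \<Rightarrow> real^'n" where f: "smooth_map A f" "image_T10_eq A f \<tau>" "\<forall>p. f p \<in> sphere 0 1"
    unfolding is_complex_gauss_map_def kaehler_immersion_def by blast
  then show "\<exists>f :: 'a \<Rightarrow> real^'n. real_section_N A \<tau> f \<and> image_T10_eq A f \<tau>"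
    using sphere_imp_section[OF assms] by blast
next
  assume "\<exists>f :: 'a \<Rightarrow> real^'n. real_section_N A \<tau> f \<and> image_T10_eq A f \<tau>"
  then obtain f :: "'a \<Rightarrow> real^'n" where f: "real_section_N A \<tau> f" "image_T10_eq A f \<tau>" by blast
  note h = normalized_section[OF assms f]
  show "\<exists>f :: 'a \<Rightarrow> real^'n. kaehler_immersion A f \<and> (\<forall>p. f p \<in> sphere 0 1) \<and>
            parallel_pluri_mean_curvature A f \<and> is_complex_gauss_map A f \<tau>"
    using gauss_map_immersion[OF assms h(1,2)] h unfolding is_complex_gauss_map_def by blast
qed

end
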